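(* Let $x_a,z_a\in\mathbb{R}$ be fixed. For $x\in C^1([a,b];\mathbb{R})$ with $x(a)=x_a$, let $z=z(x,\cdot)$ be defined by $$\dot z(x,t)=L\left(t,x(t),{}^CD_\gamma^{\alpha(\cdot,\cdot),\beta(\cdot,\cdot)}x(t),z(t)\right),\quad t\in[a,b],\qquad z(a)=z_a,$$ where $L$ satisfies hypotheses (i) and (ii) listed in the context. Consider the problem of determining the trajectories $x\in C^1([a,b];\mathbb{R})$ with $x(a)=x_a$, and a real $T\in(a,b]$, that extremize (maximize or minimize) the value $z(x,T)$. Let $x\in C^1([a,b];\mathbb{R})$, $x(a)=x_a$, be such that $z$ has, in this sense, an extremum at $T\in(a,b]$. Then $(x,z)$ satisfies the fractional differential equations $$\partial_2L[x,z]_\gamma^{\alpha,\beta}(t)\lambda(t)+D_{\overline\gamma}^{\beta(\cdot,\cdot),\alpha(\cdot,\cdot)}\left(\lambda(t)\partial_3L[x,z]_\gamma^{\alpha,\beta}(t)\right)=0$$ on $[a,T]$, and $$\gamma_2\left({}_aD_t^{\beta(\cdot,\cdot)}\left(\lambda(t)\partial_3L[x,z]_\gamma^{\alpha,\beta}(t)\right)-{}_TD_t^{\beta(\cdot,\cdot)}\left(\lambda(t)\partial_3L[x,z]_\gamma^{\alpha,\beta}(t)\right)\right)=0$$ on $[T,b]$. Moreover, the following transversality conditions are satisfied: $$ \begin{cases} \left[\gamma_1\,{}_tI_T^{1-\alpha(\cdot,\cdot)}\left(\lambda(t)\partial_3L[x,z]_\gamma^{\alpha,\beta}(t)\right)-\gamma_2\,{}_TI_t^{1-\beta(\cdot,\cdot)}\left(\lambda(t)\partial_3L[x,z]_\gamma^{\alpha,\beta}(t)\right)\right]_{t=T}=0,\\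 \gamma_2\left[{}_TI_t^{1-\beta(\cdot,\cdot)}\left(\lambda(t)\partial_3L[x,z]_\gamma^{\alpha,\beta}(t)\right)-{}_aI_t^{1-\beta(\cdot,\cdot)}\left(\lambda(t)\partial_3L[x,z]_\gamma^{\alpha,\beta}(t)\right)\right]_{t=b}=0. \end{cases} $$ If $T<b$, then $L[x,z]_\gamma^{\alpha,\beta}(T)=0$.
   Context: Let $a<b$ be reals, $\alpha,\beta:[a,b]^2\to(0,1)$ continuous functions, and $\gamma=(\gamma_1,\gamma_2)\in[0,1]^2$ with $\gamma_1,\gamma_2$ not both zero; $\overline\gamma=(\gamma_2,\gamma_1)$. For $c\in[a,b]$ and $\delta\in\{\alpha,\beta\}$ define the variable-order Riemann--Liouville integrals $${}_cI_t^{1-\delta(\cdot,\cdot)}f(t)=\int_c^t\frac{(t-\tau)^{-\delta(t,\tau)}}{\Gamma(1-\delta(t,\tau))}f(\tau)\,d\tau\ (t>c),\qquad {}_tI_c^{1-\delta(\cdot,\cdot)}f(t)=\int_t^c\frac{(\tau-t)^{-\delta(\tau,t)}}{\Gamma(1-\delta(\tau,t))}f(\tau)\,d\tau\ (t<c),$$ the Riemann--Liouville derivatives ${}_cD_t^{\delta(\cdot,\cdot)}f(t)=\frac{d}{dt}\,{}_cI_t^{1-\delta(\cdot,\cdot)}f(t)$ and ${}_tD_c^{\delta(\cdot,\cdot)}f(t)=-\frac{d}{dt}\,{}_tI_c^{1-\delta(\cdot,\cdot)}f(t)$, and the Caputo derivatives ${}_a^CD_t^{\alpha(\cdot,\cdot)}x(t)={}_aI_t^{1-\alpha(\cdot,\cdot)}x'(t)$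 and ${}_t^CD_b^{\beta(\cdot,\cdot)}x(t)=-{}_tI_b^{1-\beta(\cdot,\cdot)}x'(t)$. The combined Caputo fractional derivative is ${}^CD_\gamma^{\alpha(\cdot,\cdot),\beta(\cdot,\cdot)}x(t)=\gamma_1\,{}_a^CD_t^{\alpha(\cdot,\cdot)}x(t)+\gamma_2\,{}_t^CD_b^{\beta(\cdot,\cdot)}x(t)$, and the dual derivative is $D_{\overline\gamma}^{\beta(\cdot,\cdot),\alpha(\cdot,\cdot)}=\gamma_2\,{}_aD_t^{\beta(\cdot,\cdot)}+\gamma_1\,{}_tD_T^{\alpha(\cdot,\cdot)}$. Notation: $[x,z]_\gamma^{\alpha,\beta}(t)=\left(t,x(t),{}^CD_\gamma^{\alpha(\cdot,\cdot),\beta(\cdot,\cdot)}x(t),z(t)\right)$; $L[x,z]_\gamma^{\alpha,\beta}(t)$ means $L$ evaluated at this vector; $\partial_iL$ is the partial derivative with respect to the $i$th argument; $$\lambda(t)=\exp\left(-\int_a^t\partial_4L[x,z]_\gamma^{\alpha,\beta}(\tau)\,d\tau\right).$$ Hypotheses on $L$: (i) $L:[a,b]\times\mathbb{R}^3\to\mathbb{R}$ is differentiable; (ii) $t\mapsto\lambda(t)\partial_3L[x,z]_\gamma^{\alpha,\beta}(t)$ is such that ${}_TD_t^{\beta(\cdot,\cdot)}\left(\lambda(t)\partial_3L[x,z]_\gamma^{\alpha,\beta}(t)\right)$, ${}_aD_t^{\beta(\cdot,\cdot)}\left(\lambda(t)\partial_3L[x,z]_\gamma^{\alpha,\beta}(t)\right)$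 and $D_{\overline\gamma}^{\beta(\cdot,\cdot),\alpha(\cdot,\cdot)}\left(\lambda(t)\partial_3L[x,z]_\gamma^{\alpha,\beta}(t)\right)$ exist and are continuous on $[a,b]$.
   Formalization: In hypothesis (i), besides differentiability of L, the partial derivatives ∂₂L, ∂₃L and ∂₄L are assumed continuous on [a,b]×ℝ³; with bare differentiability the first equation can fail at a point. *)

theory Defs
  imports "HOL-Analysis.Analysis"
begin

(* Variable-order Riemann-Liouville integrals of order 1 - d, with lower (resp. upper)
   base point c.  At t = c the defining formula is an integral over a one-point set, so
   the value is 0; for bounded measurable f this is also the one-sided limit at c. *)

definition RL_int_left :: "(real \<Rightarrow> real \<Rightarrow> real) \<Rightarrow> real \<Rightarrow> (real \<Rightarrow> real) \<Rightarrow> real \<Rightarrow> real" where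
  "RL_int_left d c f t =
     (LINT \<tau>:{c..t}|lborel. (t - \<tau>) powr (- d t \<tau>) / Gamma (1 - d t \<tau>) * f \<tau>)"

definition RL_int_right :: "(real \<Rightarrow> real \<Rightarrow> real) \<Rightarrow> real \<Rightarrow> (real \<Rightarrow> real) \<Rightarrow> real \<Rightarrow> real" where
  "RL_int_right d c f t =
     (LINT \<tau>:{t..c}|lborel. (\<tau> - t) powr (- d \<tau> t) / Gamma (1 - d \<tau> t) * f \<tau>)"

(* The left derivative with base point c lives on {c..b}, the right one on {a..c};
   derivatives at the end points of these intervals are one-sided. *)

definition RL_deriv_left :: "real \<Rightarrow> (real \<Rightarrow> real \<Rightarrow> real) \<Rightarrow> real \<Rightarrow> (real \<Rightarrow> real) \<Rightarrow> real \<Rightarrow> real" where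
  "RL_deriv_left b d c f t = vector_derivative (RL_int_left d c f) (at t within {c..b})"

definition RL_deriv_right :: "real \<Rightarrow> (real \<Rightarrow> real \<Rightarrow> real) \<Rightarrow> real \<Rightarrow> (real \<Rightarrow> real) \<Rightarrow> real \<Rightarrow> real" where
  "RL_deriv_right a d c f t = - vector_derivative (RL_int_right d c f) (at t within {a..c})"

(* Combined operator g1 * aD_t^d1 + g2 * tD_T^d2, for t in {a..T}. *)

definition RL_deriv_comb ::
  "real \<Rightarrow> real \<Rightarrow> real \<Rightarrow> real \<times> real \<Rightarrow> (real \<Rightarrow> real \<Rightarrow> real) \<Rightarrow> (real \<Rightarrow> real \<Rightarrow> real)
    \<Rightarrow> (real \<Rightarrow> real) \<Rightarrow> real \<Rightarrow> real" where
  "RL_deriv_comb a b T g d1 d2 f t =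
     fst g * RL_deriv_left b d1 a f t + snd g * RL_deriv_right a d2 T f t"

definition C1_on :: "real \<Rightarrow> real \<Rightarrow> (real \<Rightarrow> real) \<Rightarrow> bool" where
  "C1_on a b x \<longleftrightarrow> x differentiable_on {a..b} \<and>
     continuous_on {a..b} (\<lambda>t. vector_derivative x (at t within {a..b}))"

definition caputo_left :: "real \<Rightarrow> real \<Rightarrow> (real \<Rightarrow> real \<Rightarrow> real) \<Rightarrow> (real \<Rightarrow> real) \<Rightarrow> real \<Rightarrow> real" where
  "caputo_left a b d x t =
     RL_int_left d a (\<lambda>\<tau>. vector_derivative x (at \<tau> within {a..b})) t"

definition caputo_right :: "real \<Rightarrow> real \<Rightarrow> (real \<Rightarrow> real \<Rightarrow> real) \<Rightarrow> (real \<Rightarrow> real) \<Rightarrow> real \<Rightarrow> real" where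
  "caputo_right a b d x t =
     - RL_int_right d b (\<lambda>\<tau>. vector_derivative x (at \<tau> within {a..b})) t"

definition caputo_comb ::
  "real \<Rightarrow> real \<Rightarrow> real \<times> real \<Rightarrow> (real \<Rightarrow> real \<Rightarrow> real) \<Rightarrow> (real \<Rightarrow> real \<Rightarrow> real)
    \<Rightarrow> (real \<Rightarrow> real) \<Rightarrow> real \<Rightarrow> real" where
  "caputo_comb a b g d1 d2 x t = fst g * caputo_left a b d1 x t + snd g * caputo_right a b d2 x t"

definition bracket ::
  "real \<Rightarrow> real \<Rightarrow> real \<times> real \<Rightarrow> (real \<Rightarrow> real \<Rightarrow> real) \<Rightarrow> (real \<Rightarrow> real \<Rightarrow> real)
    \<Rightarrow> (real \<Rightarrow> real) \<Rightarrow> (real \<Rightarrow> real) \<Rightarrow> real \<Rightarrow> real \<times> real \<times> real \<times> real" where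
  "bracket a b g d1 d2 x z t = (t, x t, caputo_comb a b g d1 d2 x t, z t)"

definition partial2 :: "(real \<times> real \<times> real \<times> real \<Rightarrow> real) \<Rightarrow> real \<times> real \<times> real \<times> real \<Rightarrow> real" where
  "partial2 L = (\<lambda>(t, u, v, w). deriv (\<lambda>s. L (t, s, v, w)) u)"

definition partial3 :: "(real \<times> real \<times> real \<times> real \<Rightarrow> real) \<Rightarrow> real \<times> real \<times> real \<times> real \<Rightarrow> real" where
  "partial3 L = (\<lambda>(t, u, v, w). deriv (\<lambda>s. L (t, u, s, w)) v)"

definition partial4 :: "(real \<times> real \<times> real \<times> real \<Rightarrow> real) \<Rightarrow> real \<times> real \<times> real \<times> real \<Rightarrow> real" where
  "partial4 L = (\<lambda>(t, u, v, w). deriv (\<lambda>s. L (t, u, v, s)) w)"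

definition herglotz_multiplier ::
  "real \<Rightarrow> real \<Rightarrow> real \<times> real \<Rightarrow> (real \<Rightarrow> real \<Rightarrow> real) \<Rightarrow> (real \<Rightarrow> real \<Rightarrow> real)
    \<Rightarrow> (real \<times> real \<times> real \<times> real \<Rightarrow> real) \<Rightarrow> (real \<Rightarrow> real) \<Rightarrow> (real \<Rightarrow> real) \<Rightarrow> real \<Rightarrow> real" where
  "herglotz_multiplier a b g d1 d2 L x z t =
     exp (- (LINT \<tau>:{a..t}|lborel. partial4 L (bracket a b g d1 d2 x z \<tau>)))"

definition admissible :: "real \<Rightarrow> real \<Rightarrow> real \<Rightarrow> (real \<Rightarrow> real) \<Rightarrow> bool" where
  "admissible a b xa x \<longleftrightarrow> C1_on a b x \<and> x a = xa"

definition herglotz_solution ::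
  "real \<Rightarrow> real \<Rightarrow> real \<times> real \<Rightarrow> (real \<Rightarrow> real \<Rightarrow> real) \<Rightarrow> (real \<Rightarrow> real \<Rightarrow> real)
    \<Rightarrow> (real \<times> real \<times> real \<times> real \<Rightarrow> real) \<Rightarrow> real \<Rightarrow> (real \<Rightarrow> real) \<Rightarrow> (real \<Rightarrow> real) \<Rightarrow> bool" where
  "herglotz_solution a b g d1 d2 L za x z \<longleftrightarrow> z a = za \<and>
     (\<forall>t\<in>{a..b}. (z has_real_derivative L (bracket a b g d1 d2 x z t)) (at t within {a..b}))"

definition C1_near :: "real \<Rightarrow> real \<Rightarrow> real \<Rightarrow> (real \<Rightarrow> real) \<Rightarrow> (real \<Rightarrow> real) \<Rightarrow> bool" where
  "C1_near a b e x y \<longleftrightarrow> (\<forall>t\<in>{a..b}. \<bar>y t - x t\<bar> < e \<and>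
     \<bar>vector_derivative y (at t within {a..b}) - vector_derivative x (at t within {a..b})\<bar> < e)"

(* Local extremum with respect to the C1 distance for the trajectory and the usual distance
   for the terminal time; global extrema are a special case. *)

definition herglotz_extremum ::
  "real \<Rightarrow> real \<Rightarrow> real \<Rightarrow> ((real \<Rightarrow> real) \<Rightarrow> real \<Rightarrow> real) \<Rightarrow> (real \<Rightarrow> real) \<Rightarrow> real \<Rightarrow> bool" where
  "herglotz_extremum a b xa z x T \<longleftrightarrow>
     admissible a b xa x \<and> T \<in> {a<..b} \<and>
     (\<exists>e>0.
        (\<forall>y S. admissible a b xa y \<and> S \<in> {a<..b} \<and> C1_near a b e x y \<and> \<bar>S - T\<bar> < e
           \<longrightarrow> z y S \<le> z x T) \<or>
        (\<forall>y S. admissible a b xa y \<and> S \<in> {a<..b} \<and> C1_near a b e x y \<and> \<bar>S - T\<bar> < e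
           \<longrightarrow> z x T \<le> z y S))"

end

theory Submission
  imports Defs
begin

text \<open>Fix a variation \<open>h\<close> with \<open>h a = 0\<close>. Linearizing the Herglotz equation and removing the
  dependence on \<open>z\<close> with the integrating factor \<open>lam\<close>, the derivative of \<open>z (x + \<epsilon> * h) T\<close> at
  \<open>\<epsilon> = 0\<close> is, up to the factor \<open>1 / lam T\<close>, the integral over \<open>{a..T}\<close> of
  \<open>lam * (\<partial>\<^sub>2L * h + \<partial>\<^sub>3L * k)\<close>, where \<open>k\<close> is the combined Caputo derivative of \<open>h\<close>.
  Fubini's theorem moves the weakly singular kernels from \<open>h'\<close> to \<open>\<phi> = lam * \<partial>\<^sub>3L\<close> and turns this
  into the integral of \<open>h' * G\<close> over \<open>{a..b}\<close>, with \<open>G\<close> continuous. Choosing \<open>h' = G\<close> gives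
  \<open>G = 0\<close>; differentiating this identity yields the Euler-Lagrange equations and its values at \<open>T\<close>
  and \<open>b\<close> yield the transversality conditions. The last claim is Fermat's criterion for \<open>z x\<close>.\<close>

subsection \<open>Dependence of the Herglotz equation on a parameter\<close>

text \<open>Heine-Cantor for the shifted function on the compact set of times and shifts of size at
  most 1; the strip itself is unbounded, hence the box. The radius obtained does not depend on
  \<open>t\<close>.\<close>

lemma uniform_continuity_along_curve:
  fixes P :: "real \<times> real \<times> real \<times> real \<Rightarrow> real"
  assumes P: "continuous_on ({a..b} \<times> UNIV) P"
    and x: "continuous_on {a..b} x" and v: "continuous_on {a..b} v" and w: "continuous_on {a..b} w"
    and \<eta>: "\<eta> > 0"
  shows "\<exists>\<delta>>0. \<forall>t\<in>{a..b}. \<forall>p q r. \<bar>p\<bar> \<le> \<delta> \<longrightarrow> \<bar>q\<bar> \<le> \<delta> \<longrightarrow> \<bar>r\<bar> \<le> \<delta> \<longrightarrow>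
           \<bar>P (t, x t + p, v t + q, w t + r) - P (t, x t, v t, w t)\<bar> \<le> \<eta>"
proof -
  let ?K = "{a..b} \<times> {-1..1::real} \<times> {-1..1::real} \<times> {-1..1::real}"
  let ?F = "\<lambda>(t, p, q, r). P (t, x t + p, v t + q, w t + r)"
  have "compact ?K"
    by (intro compact_Times compact_Icc)
  moreover have "continuous_on ?K ?F"
  proof -
    have [continuous_intros]: "continuous_on ({a..b} \<times> U) (\<lambda>y. f (fst y))"
      if "continuous_on {a..b} f" for f :: "real \<Rightarrow> real" and U :: "(real \<times> real \<times> real) set"
      by (rule continuous_on_compose2[OF that]) (auto intro!: continuous_intros)
    show ?thesis
      unfolding split_beta
      by (rule continuous_on_compose2[OF P]) (auto intro!: continuous_intros x v w)
  qed
  ultimately have "uniformly_continuous_on ?K ?F"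
    by (rule compact_uniformly_continuous[rotated])
  from this[unfolded uniformly_continuous_on_def, rule_format, OF \<eta>] obtain d where d: "d > 0"
    and D: "\<forall>y\<in>?K. \<forall>y'\<in>?K. dist y' y < d \<longrightarrow> dist (?F y') (?F y) < \<eta>"
    by (elim exE conjE)
  \<comment> \<open>At most 1 to stay inside the box; three shifts of size \<open>d / 4\<close> add
    up to less than \<open>d\<close>.\<close>
  define \<delta> where "\<delta> = min 1 (d / 4)"
  show ?thesis
  proof (intro exI[of _ \<delta>] conjI ballI allI impI)
    show "\<delta> > 0" using d by (simp add: \<delta>_def)
    fix t p q r assume H: "t \<in> {a..b}" "\<bar>p\<bar> \<le> \<delta>" "\<bar>q\<bar> \<le> \<delta>" "\<bar>r\<bar> \<le> \<delta>"
    have "dist (t, p, q, r) (t, 0, 0, 0) \<le> \<bar>p\<bar> + (\<bar>q\<bar> + \<bar>r\<bar>)"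
      unfolding dist_Pair_Pair dist_self
      using sqrt_sum_squares_le_sum_abs[of p "sqrt (q\<^sup>2 + r\<^sup>2)"] sqrt_sum_squares_le_sum_abs[of q r]
      by (simp add: dist_real_def)
    also have "\<dots> < d" using H d by (auto simp: \<delta>_def)
    finally have "dist (P (t, x t + p, v t + q, w t + r)) (P (t, x t + 0, v t + 0, w t + 0)) < \<eta>"
      using D[rule_format, of "(t,0,0,0)" "(t,p,q,r)"] H by (auto simp: \<delta>_def abs_le_iff)
    then show "\<bar>P (t, x t + p, v t + q, w t + r) - P (t, x t, v t, w t)\<bar> \<le> \<eta>"
      by (simp add: dist_real_def)
  qed
qed

text \<open>At \<open>t = a\<close> and \<open>t = b\<close> the differentiability of
  \<open>L\<close> is one-sided only in the first argument. A curve that moves one of the other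
  arguments stays in the strip, so the chain rule within its range gives two-sided partial
  derivatives there as well.\<close>

lemma partial_has_derivative:
  fixes L :: "real \<times> real \<times> real \<times> real \<Rightarrow> real"
  assumes L: "L differentiable_on ({a..b} \<times> UNIV)" and t: "t \<in> {a..b}"
  shows "((\<lambda>s. L (t, s, v, w)) has_real_derivative partial2 L (t, u, v, w)) (at u)"
    and "((\<lambda>s. L (t, u, s, w)) has_real_derivative partial3 L (t, u, v, w)) (at v)"
    and "((\<lambda>s. L (t, u, v, s)) has_real_derivative partial4 L (t, u, v, w)) (at w)"
proof -
  have *: "((\<lambda>s. L (c s)) has_real_derivative deriv (\<lambda>s. L (c s)) s0) (at s0)"
    if c: "c differentiable at s0" "range c \<subseteq> {a..b} \<times> UNIV" for c :: "real \<Rightarrow> _" and s0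
  proof -
    have "c s0 \<in> {a..b} \<times> UNIV" using c(2) by blast
    then have "L differentiable at (c s0) within {a..b} \<times> UNIV"
      by (rule L[unfolded differentiable_on_def, rule_format])
    then have "L differentiable at (c s0) within range c"
      using c(2) by (rule differentiable_within_subset)
    then have "(L \<circ> c) differentiable at s0 within UNIV"
      using c(1) by (intro differentiable_chain_within) auto
    then show ?thesis
      by (simp add: o_def DERIV_deriv_iff_real_differentiable)
  qed
  have dP: "(\<lambda>s. (f s, g s)) differentiable at s0"
    if "f differentiable at s0" "g differentiable at s0"
    for f :: "real \<Rightarrow> 'x::real_normed_vector" and g :: "real \<Rightarrow> 'y::real_normed_vector" and s0
    using that unfolding differentiable_def by (blast intro: has_derivative_Pair)
  show "((\<lambda>s. L (t, s, v, w)) has_real_derivative partial2 L (t, u, v, w)) (at u)"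
    and "((\<lambda>s. L (t, u, s, w)) has_real_derivative partial3 L (t, u, v, w)) (at v)"
    and "((\<lambda>s. L (t, u, v, s)) has_real_derivative partial4 L (t, u, v, w)) (at w)"
    unfolding partial2_def partial3_def partial4_def case_prod_conv
    by (rule *; use t in \<open>auto intro!: dP\<close>)+
qed

lemma mean_value_real:
  fixes f :: "real \<Rightarrow> real"
  assumes "\<And>s. (f has_real_derivative f' s) (at s)"
  shows "\<exists>\<theta>. \<bar>\<theta>\<bar> \<le> \<bar>p\<bar> \<and> f (u + p) - f u = f' (u + \<theta>) * p"
proof -
  consider "p = 0" | "p > 0" | "p < 0" by linarith
  then show ?thesis
  proof cases
    case 1 then show ?thesis by (intro exI[of _ 0]) auto
  next
    case 2
    obtain z where "u < z" "z < u + p" "f (u + p) - f u = (u + p - u) * f' z"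
      using MVT2[of u "u + p" f f'] assms 2 by auto
    then show ?thesis by (intro exI[of _ "z - u"]) auto
  next
    case 3
    obtain z where "u + p < z" "z < u" "f u - f (u + p) = (u - (u + p)) * f' z"
      using MVT2[of "u + p" u f f'] assms 3 by auto
    then show ?thesis by (intro exI[of _ "z - u"]) (auto simp: algebra_simps)
  qed
qed

text \<open>The increment telescopes, one argument at a time. The mean value theorem turns each part
  into a partial derivative at an intermediate point, which differs by at most \<eta> from its value
  on the curve. What matters later is that the radius is uniform in \<open>t\<close>.\<close>

lemma uniform_linearization:
  fixes L :: "real \<times> real \<times> real \<times> real \<Rightarrow> real"
  assumes L: "L differentiable_on ({a..b} \<times> UNIV)"
    and P2: "continuous_on ({a..b} \<times> UNIV) (partial2 L)"
    and P3: "continuous_on ({a..b} \<times> UNIV) (partial3 L)"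
    and P4: "continuous_on ({a..b} \<times> UNIV) (partial4 L)"
    and x: "continuous_on {a..b} x" and v: "continuous_on {a..b} v" and w: "continuous_on {a..b} w"
    and \<eta>: "\<eta> > 0"
  obtains \<delta> where "\<delta> > 0"
    "\<And>t p q r. t \<in> {a..b} \<Longrightarrow> \<bar>p\<bar> \<le> \<delta> \<Longrightarrow> \<bar>q\<bar> \<le> \<delta> \<Longrightarrow> \<bar>r\<bar> \<le> \<delta> \<Longrightarrow>
      \<bar>L (t, x t + p, v t + q, w t + r) - L (t, x t, v t, w t)
        - (partial2 L (t, x t, v t, w t) * p + partial3 L (t, x t, v t, w t) * q
           + partial4 L (t, x t, v t, w t) * r)\<bar> \<le> \<eta> * (\<bar>p\<bar> + \<bar>q\<bar> + \<bar>r\<bar>)"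
proof -
  let ?close = "\<lambda>P \<delta>. \<forall>t\<in>{a..b}. \<forall>p q r. \<bar>p\<bar> \<le> \<delta> \<longrightarrow> \<bar>q\<bar> \<le> \<delta> \<longrightarrow> \<bar>r\<bar> \<le> \<delta> \<longrightarrow>
           \<bar>P (t, x t + p, v t + q, w t + r) - P (t, x t, v t, w t)\<bar> \<le> \<eta>"
  obtain d2 where d2: "d2 > 0" "?close (partial2 L) d2"
    using uniform_continuity_along_curve[OF P2 x v w \<eta>] by (elim exE conjE)
  obtain d3 where d3: "d3 > 0" "?close (partial3 L) d3"
    using uniform_continuity_along_curve[OF P3 x v w \<eta>] by (elim exE conjE)
  obtain d4 where d4: "d4 > 0" "?close (partial4 L) d4"
    using uniform_continuity_along_curve[OF P4 x v w \<eta>] by (elim exE conjE)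
  show thesis
  proof (rule that[of "min d2 (min d3 d4)"])
    show "min d2 (min d3 d4) > 0" using d2 d3 d4 by simp
    fix t p q r assume t: "t \<in> {a..b}" and
      small: "\<bar>p\<bar> \<le> min d2 (min d3 d4)" "\<bar>q\<bar> \<le> min d2 (min d3 d4)" "\<bar>r\<bar> \<le> min d2 (min d3 d4)"
    obtain \<theta>2 where 2: "\<bar>\<theta>2\<bar> \<le> \<bar>p\<bar>" "L (t, x t + p, v t + q, w t + r) - L (t, x t, v t + q, w t + r)
        = partial2 L (t, x t + \<theta>2, v t + q, w t + r) * p"
      using mean_value_real[OF partial_has_derivative(1)[OF L t]] by blast
    obtain \<theta>3 where 3: "\<bar>\<theta>3\<bar> \<le> \<bar>q\<bar>" "L (t, x t, v t + q, w t + r) - L (t, x t, v t, w t + r)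
        = partial3 L (t, x t, v t + \<theta>3, w t + r) * q"
      using mean_value_real[OF partial_has_derivative(2)[OF L t]] by blast
    obtain \<theta>4 where 4: "\<bar>\<theta>4\<bar> \<le> \<bar>r\<bar>" "L (t, x t, v t, w t + r) - L (t, x t, v t, w t)
        = partial4 L (t, x t, v t, w t + \<theta>4) * r"
      using mean_value_real[OF partial_has_derivative(3)[OF L t]] by blast
    have c2: "\<bar>partial2 L (t, x t + \<theta>2, v t + q, w t + r) - partial2 L (t, x t, v t, w t)\<bar> \<le> \<eta>"
      using small 2(1) by (intro d2(2)[rule_format, OF t]) linarith+
    have c3: "\<bar>partial3 L (t, x t, v t + \<theta>3, w t + r) - partial3 L (t, x t, v t, w t)\<bar> \<le> \<eta>"
      using d3(2)[rule_format, OF t, of 0 \<theta>3 r] small 3(1) d3(1) by simp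
    have c4: "\<bar>partial4 L (t, x t, v t, w t + \<theta>4) - partial4 L (t, x t, v t, w t)\<bar> \<le> \<eta>"
      using d4(2)[rule_format, OF t, of 0 0 \<theta>4] small 4(1) d4(1) by simp
    have "L (t, x t + p, v t + q, w t + r) - L (t, x t, v t, w t)
        - (partial2 L (t, x t, v t, w t) * p + partial3 L (t, x t, v t, w t) * q
           + partial4 L (t, x t, v t, w t) * r)
      = (partial2 L (t, x t + \<theta>2, v t + q, w t + r) - partial2 L (t, x t, v t, w t)) * p
        + (partial3 L (t, x t, v t + \<theta>3, w t + r) - partial3 L (t, x t, v t, w t)) * q
        + (partial4 L (t, x t, v t, w t + \<theta>4) - partial4 L (t, x t, v t, w t)) * r"
      using 2(2) 3(2) 4(2) by (simp add: algebra_simps)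
    also have "\<bar>\<dots>\<bar> \<le> \<eta> * \<bar>p\<bar> + \<eta> * \<bar>q\<bar> + \<eta> * \<bar>r\<bar>"
      by (intro order_trans[OF abs_triangle_ineq] add_mono)
        (auto simp: abs_mult intro!: mult_right_mono c2 c3 c4)
    finally show "\<bar>L (t, x t + p, v t + q, w t + r) - L (t, x t, v t, w t)
        - (partial2 L (t, x t, v t, w t) * p + partial3 L (t, x t, v t, w t) * q
           + partial4 L (t, x t, v t, w t) * r)\<bar> \<le> \<eta> * (\<bar>p\<bar> + \<bar>q\<bar> + \<bar>r\<bar>)"
      by (simp add: algebra_simps)
  qed
qed

text \<open>The differential inequality is only assumed inside the tube of radius \<delta>; the solution
  cannot leave the tube because it stays below an exponential barrier.\<close>

lemma exponential_barrier:
  fixes w w' :: "real \<Rightarrow> real"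
  assumes w: "\<And>t. t \<in> {a..b} \<Longrightarrow> (w has_real_derivative w' t) (at t within {a..b})"
    and w0: "w a = 0"
    and ineq: "\<And>t. t \<in> {a..b} \<Longrightarrow> \<bar>w t\<bar> \<le> \<delta> \<Longrightarrow> \<bar>w' t\<bar> < c + K * \<bar>w t\<bar>"
    and c: "c > 0" and K: "K \<ge> 0"
    and tube: "c * exp ((K + 1) * (b - a)) \<le> \<delta>"
    and t: "t \<in> {a..b}"
  shows "\<bar>w t\<bar> \<le> c * exp ((K + 1) * (b - a))"
proof -
  define B where "B = (\<lambda>t. c * exp ((K + 1) * (t - a)))"
  have B': "(B has_real_derivative (K + 1) * B t) (at t within S)" for t S
    unfolding B_def by (auto intro!: derivative_eq_intros)
  have Bc: "B t \<ge> c" if "t \<ge> a" for t using that c K by (simp add: B_def)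
  have Bb: "B t \<le> c * exp ((K + 1) * (b - a))" if "t \<le> b" for t
    using that c K by (auto simp: B_def intro!: mult_left_mono)
  have contw: "continuous_on {a..b} w"
    using w by (meson DERIV_continuous continuous_on_eq_continuous_within)
  have "\<bar>w t\<bar> < B t" if t: "t \<in> {a..b}" for t
  proof (rule ccontr)
    assume neg: "\<not> \<bar>w t\<bar> < B t"
    \<comment> \<open>\<open>Inf S\<close> is the first time at which \<open>\<bar>w\<bar>\<close>
      touches the barrier; closedness of \<open>S\<close> makes it a minimum.\<close>
    define S where "S = {s \<in> {a..b}. B s \<le> \<bar>w s\<bar>}"
    have "continuous_on {a..b} B" using B' by (meson DERIV_continuous continuous_on_eq_continuous_within)
    then have "closed S" unfolding S_def
      by (rule continuous_on_closed_Collect_le[OF _ continuous_on_rabs[OF contw] closed_atLeastAtMost])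
    moreover have "S \<noteq> {}" "bdd_below S" using neg t by (auto simp: S_def)
    ultimately have mem: "Inf S \<in> S" using closed_contains_Inf by blast
    define s where "s = Inf S"
    have s: "s \<in> {a..b}" "B s \<le> \<bar>w s\<bar>" using mem by (auto simp: S_def s_def)
    have before: "\<bar>w r\<bar> < B r" if "r \<in> {a..b}" "r < s" for r
      using that cInf_lower[of r S] \<open>bdd_below S\<close> by (fastforce simp: S_def s_def)
    have "s \<noteq> a" using s w0 Bc[of a] c by auto
    then have as: "a < s" using s by auto
    have eq: "\<bar>w s\<bar> = B s"
    proof (rule antisym)
      have tr: "at s within {a..<s} \<noteq> bot"
        using as by (simp add: at_within_eq_bot_iff)
      have "((\<lambda>r. \<bar>w r\<bar>) \<longlongrightarrow> \<bar>w s\<bar>) (at s within {a..<s})"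
      proof (rule tendsto_rabs, rule tendsto_within_subset)
        show "(w \<longlongrightarrow> w s) (at s within {a..b})"
          using contw s(1) unfolding continuous_on_def by blast
      qed (use s in auto)
      moreover have "(B \<longlongrightarrow> B s) (at s within {a..<s})"
        using B' DERIV_continuous continuous_within by blast
      moreover have "\<forall>\<^sub>F r in at s within {a..<s}. \<bar>w r\<bar> \<le> B r"
        using before s by (simp add: eventually_at_filter less_imp_le)
      ultimately show "\<bar>w s\<bar> \<le> B s" using tendsto_le[OF tr] by blast
    qed (use s in auto)
    \<comment> \<open>By \<open>tube\<close> the touching point lies inside the tube, so
      \<open>ineq\<close> applies. The \<open>+ 1\<close> in the exponent absorbs \<open>c\<close>,
      because \<open>c \<le> B s\<close>.\<close>
    have slope: "\<bar>w' s\<bar> < (K + 1) * B s"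
      using ineq[OF s(1)] eq Bb[of s] tube Bc[of s] s by (auto simp: algebra_simps)
    \<comment> \<open>\<open>\<sigma> * w\<close> is a differentiable substitute for
      \<open>\<bar>w\<bar>\<close>: equal to it at \<open>s\<close> and below it elsewhere. A
      negative slope of \<open>\<sigma> * w - B\<close> at its zero \<open>s\<close> puts
      \<open>\<bar>w\<bar>\<close> above \<open>B\<close> slightly earlier, against the choice of
      \<open>s\<close>.\<close>
    define \<sigma> where "\<sigma> = sgn (w s)"
    have \<sigma>: "\<bar>\<sigma>\<bar> \<le> 1" "\<sigma> * w s = \<bar>w s\<bar>" by (auto simp: \<sigma>_def sgn_if)
    have "((\<lambda>r. \<sigma> * w r - B r) has_real_derivative \<sigma> * w' s - (K + 1) * B s) (at s within {a..b})"
      by (intro DERIV_diff DERIV_cmult w s B')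
    moreover have "\<sigma> * w' s - (K + 1) * B s < 0"
      using slope \<sigma>(1) by (auto simp: \<sigma>_def sgn_if)
    ultimately have "\<exists>d>0. \<forall>h>0. s - h \<in> {a..b} \<longrightarrow> h < d \<longrightarrow> \<sigma> * w s - B s < \<sigma> * w (s - h) - B (s - h)"
      by (rule has_real_derivative_neg_dec_left)
    then obtain d where d: "d > 0"
      "\<And>h. h > 0 \<Longrightarrow> s - h \<in> {a..b} \<Longrightarrow> h < d \<Longrightarrow> \<sigma> * w s - B s < \<sigma> * w (s - h) - B (s - h)"
      by blast
    define h where "h = min (d / 2) (s - a)"
    have h: "h > 0" "s - h \<in> {a..b}" "h < d" using d as s by (auto simp: h_def)
    have "0 < \<sigma> * w (s - h) - B (s - h)" using d(2)[OF h] eq \<sigma>(2) by auto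
    moreover have "\<sigma> * w (s - h) \<le> \<bar>w (s - h)\<bar>" by (auto simp: \<sigma>_def sgn_if)
    ultimately show False using before[OF h(2)] h(1) by auto
  qed
  from order_trans[OF less_imp_le[OF this[OF t]] Bb] t show ?thesis by simp
qed

text \<open>Variation of constants solves the linearized equation. The remainder of
  \<open>Z \<epsilon>\<close> against \<open>Z 0 + \<epsilon> * \<zeta>\<close> then satisfies a
  differential inequality with forcing of size \<eta> times \<open>\<bar>\<epsilon>\<bar>\<close>,
  so the exponential barrier makes it \<open>o(\<epsilon>)\<close>. Continuity of \<open>Z\<close>
  in \<epsilon> is not presupposed; it comes out of the barrier.\<close>

lemma herglotz_first_variation:
  fixes L :: "real \<times> real \<times> real \<times> real \<Rightarrow> real" and Z :: "real \<Rightarrow> real \<Rightarrow> real"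
  assumes L: "L differentiable_on ({a..b} \<times> UNIV)"
    and P2: "continuous_on ({a..b} \<times> UNIV) (partial2 L)"
    and P3: "continuous_on ({a..b} \<times> UNIV) (partial3 L)"
    and P4: "continuous_on ({a..b} \<times> UNIV) (partial4 L)"
    and x: "continuous_on {a..b} x" and v: "continuous_on {a..b} v"
    and h: "continuous_on {a..b} h" and k: "continuous_on {a..b} k"
    and Z: "\<And>\<epsilon> t. t \<in> {a..b} \<Longrightarrow>
      (Z \<epsilon> has_real_derivative L (t, x t + \<epsilon> * h t, v t + \<epsilon> * k t, Z \<epsilon> t)) (at t within {a..b})"
    and Za: "\<And>\<epsilon>. Z \<epsilon> a = Z 0 a"
    and T: "T \<in> {a..b}"
    and \<mu>: "\<And>t. t \<in> {a..b} \<Longrightarrow> \<mu> t = exp (- integral {a..t} (\<lambda>s. partial4 L (s, x s, v s, Z 0 s)))"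
  shows "((\<lambda>\<epsilon>. Z \<epsilon> T) has_real_derivative
      integral {a..T} (\<lambda>t. \<mu> t * (partial2 L (t, x t, v t, Z 0 t) * h t + partial3 L (t, x t, v t, Z 0 t) * k t))
        / \<mu> T) (at 0)"
proof -
  have z: "continuous_on {a..b} (Z 0)"
    using Z by (meson DERIV_continuous continuous_on_eq_continuous_within)
  have comp: "continuous_on {a..b} (\<lambda>t. P (t, x t, v t, Z 0 t))"
    if "continuous_on ({a..b} \<times> UNIV) P" for P :: "real \<times> real \<times> real \<times> real \<Rightarrow> real"
    by (rule continuous_on_compose2[OF that]) (auto intro!: continuous_intros x v z)
  define p2 p3 p4 where "p2 = (\<lambda>t. partial2 L (t, x t, v t, Z 0 t))"
    and "p3 = (\<lambda>t. partial3 L (t, x t, v t, Z 0 t))"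
    and "p4 = (\<lambda>t. partial4 L (t, x t, v t, Z 0 t))"
  have p: "continuous_on {a..b} p2" "continuous_on {a..b} p3" "continuous_on {a..b} p4"
    unfolding p2_def p3_def p4_def by (intro comp P2 P3 P4)+
  define m where "m = (\<lambda>t. exp (- integral {a..t} p4))"
  have m\<mu>: "m t = \<mu> t" if "t \<in> {a..b}" for t using \<mu>[OF that] by (simp add: m_def p4_def)
  have m': "(m has_real_derivative - p4 t * m t) (at t within {a..b})" if "t \<in> {a..b}" for t
    unfolding m_def using integral_has_real_derivative[OF p(3) that]
    by (auto intro!: derivative_eq_intros)
  have mc: "continuous_on {a..b} m"
    using m' by (meson DERIV_continuous continuous_on_eq_continuous_within)
  define J where "J = (\<lambda>t. integral {a..t} (\<lambda>t. m t * (p2 t * h t + p3 t * k t)))"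
  have J': "(J has_real_derivative m t * (p2 t * h t + p3 t * k t)) (at t within {a..b})" if "t \<in> {a..b}" for t
    unfolding J_def by (rule integral_has_real_derivative[OF _ that]) (intro continuous_intros mc p h k)
  \<comment> \<open>Since \<open>m' = - p4 * m\<close>, this quotient solves the linearized equation
    with zero initial value; \<open>\<zeta> T\<close> is the derivative sought.\<close>
  define \<zeta> where "\<zeta> = (\<lambda>t. J t / m t)"
  have m0: "m t > 0" for t by (simp add: m_def)
  have \<zeta>': "(\<zeta> has_real_derivative p2 t * h t + p3 t * k t + p4 t * \<zeta> t) (at t within {a..b})" if "t \<in> {a..b}" for t
  proof -
    have "(\<zeta> has_real_derivative (m t * (p2 t * h t + p3 t * k t) * m t - J t * (- p4 t * m t)) / (m t * m t))
       (at t within {a..b})"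
      unfolding \<zeta>_def using m0[of t] by (intro DERIV_divide J' m' that) auto
    also have "(m t * (p2 t * h t + p3 t * k t) * m t - J t * (- p4 t * m t)) / (m t * m t)
        = p2 t * h t + p3 t * k t + p4 t * \<zeta> t"
      using m0[of t] by (simp add: \<zeta>_def field_simps)
    finally show ?thesis .
  qed
  have \<zeta>c: "continuous_on {a..b} \<zeta>"
    using \<zeta>' by (meson DERIV_continuous continuous_on_eq_continuous_within)
  obtain H where H: "H \<ge> 0" "\<And>t. t \<in> {a..b} \<Longrightarrow> norm (h t) \<le> H"
    using continuous_on_compact_bound[OF compact_Icc h] by blast
  obtain K where K: "K \<ge> 0" "\<And>t. t \<in> {a..b} \<Longrightarrow> norm (k t) \<le> K"
    using continuous_on_compact_bound[OF compact_Icc k] by blast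
  obtain W where W: "W \<ge> 0" "\<And>t. t \<in> {a..b} \<Longrightarrow> norm (\<zeta> t) \<le> W"
    using continuous_on_compact_bound[OF compact_Icc \<zeta>c] by blast
  obtain Q where Q: "Q \<ge> 0" "\<And>t. t \<in> {a..b} \<Longrightarrow> norm (p4 t) \<le> Q"
    using continuous_on_compact_bound[OF compact_Icc p(3)] by blast
  \<comment> \<open>\<open>N\<close> bounds the perturbations per unit of \<epsilon>; the added 1
    makes the inequality for \<open>r'\<close> strict and the barrier constant positive. The
    exponent \<open>Q + 2\<close> in \<open>C\<close> dominates \<open>Q + \<eta> + 1\<close> for
    every \<open>\<eta> \<le> 1\<close>.\<close>
  define N where "N = H + K + W + 1"
  define C where "C = N * exp ((Q + 2) * (b - a))"
  have N: "N \<ge> 1" using H K W by (simp add: N_def)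
  have ab: "a \<le> b" using T by auto
  have "N * 1 \<le> C" unfolding C_def using N Q ab by (intro mult_left_mono) auto
  then have C: "C \<ge> N" "C > 0" using N by auto
  have est: "\<exists>s>0. \<forall>\<epsilon>. \<epsilon> \<noteq> 0 \<and> \<bar>\<epsilon>\<bar> < s \<longrightarrow> \<bar>Z \<epsilon> T - Z 0 T - \<epsilon> * \<zeta> T\<bar> \<le> \<eta> * C * \<bar>\<epsilon>\<bar>"
    if \<eta>: "\<eta> > 0" "\<eta> \<le> 1" for \<eta>
  proof -
    obtain \<delta> where \<delta>: "\<delta> > 0"
      "\<And>t p q r. t \<in> {a..b} \<Longrightarrow> \<bar>p\<bar> \<le> \<delta> \<Longrightarrow> \<bar>q\<bar> \<le> \<delta> \<Longrightarrow> \<bar>r\<bar> \<le> \<delta> \<Longrightarrow>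
      \<bar>L (t, x t + p, v t + q, Z 0 t + r) - L (t, x t, v t, Z 0 t) - (p2 t * p + p3 t * q + p4 t * r)\<bar>
        \<le> \<eta> * (\<bar>p\<bar> + \<bar>q\<bar> + \<bar>r\<bar>)"
      using uniform_linearization[OF L P2 P3 P4 x v z \<eta>(1)] unfolding p2_def p3_def p4_def by blast
    show ?thesis
    \<comment> \<open>With this range of \<epsilon>, both the barrier and each of
      \<open>\<bar>\<epsilon>\<bar> * H\<close>, \<open>\<bar>\<epsilon>\<bar> * K\<close>,
      \<open>\<bar>\<epsilon>\<bar> * W\<close> are at most \<open>\<delta> / 2\<close>. The tube
      for \<open>r\<close> thus has radius \<open>\<delta> / 2\<close>, and the full perturbation of
      the solution stays within \<delta>.\<close>
    proof (intro exI[of _ "\<delta> / (2 * C)"] conjI allI impI)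
      show "\<delta> / (2 * C) > 0" using \<delta> C by simp
      fix \<epsilon> :: real assume e: "\<epsilon> \<noteq> 0 \<and> \<bar>\<epsilon>\<bar> < \<delta> / (2 * C)"
      then have eC: "\<bar>\<epsilon>\<bar> * C < \<delta> / 2" using C by (simp add: field_simps)
      have eB: "\<bar>\<epsilon>\<bar> * B \<le> \<delta> / 2" if "B \<le> N" for B
        using mult_left_mono[of B C "\<bar>\<epsilon>\<bar>"] that C eC by linarith
      define r where "r = (\<lambda>t. Z \<epsilon> t - Z 0 t - \<epsilon> * \<zeta> t)"
      define r' where "r' = (\<lambda>t. L (t, x t + \<epsilon> * h t, v t + \<epsilon> * k t, Z \<epsilon> t) - L (t, x t, v t, Z 0 t)
         - \<epsilon> * (p2 t * h t + p3 t * k t + p4 t * \<zeta> t))"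
      have "\<bar>r T\<bar> \<le> \<eta> * \<bar>\<epsilon>\<bar> * N * exp ((Q + \<eta> + 1) * (b - a))"
      proof (rule exponential_barrier[where w = r and w' = r' and t = T and a = a and b = b
              and \<delta> = "\<delta> / 2" and c = "\<eta> * \<bar>\<epsilon>\<bar> * N" and K = "Q + \<eta>"])
        show "(r has_real_derivative r' t) (at t within {a..b})" if "t \<in> {a..b}" for t
          unfolding r_def r'_def using Z[OF that, of \<epsilon>] Z[OF that, of 0] \<zeta>'[OF that]
          by (intro DERIV_diff DERIV_cmult) auto
        show "r a = 0" using Za[of \<epsilon>] by (simp add: r_def \<zeta>_def J_def)
        show "\<eta> * \<bar>\<epsilon>\<bar> * N > 0" using \<eta> e N by simp
        show "Q + \<eta> \<ge> 0" using Q \<eta> by simp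
        have "\<eta> * \<bar>\<epsilon>\<bar> * N * exp ((Q + \<eta> + 1) * (b - a)) \<le> 1 * (\<bar>\<epsilon>\<bar> * N * exp ((Q + 2) * (b - a)))"
          unfolding mult.assoc using \<eta> N ab Q by (intro mult_mono mult_left_mono) (auto intro!: mult_right_mono)
        then show "\<eta> * \<bar>\<epsilon>\<bar> * N * exp ((Q + \<eta> + 1) * (b - a)) \<le> \<delta> / 2"
          using eC by (simp add: C_def mult.assoc)
        show "T \<in> {a..b}" by fact
        fix t assume t: "t \<in> {a..b}" and rt: "\<bar>r t\<bar> \<le> \<delta> / 2"
        define p where "p = \<epsilon> * h t" define q where "q = \<epsilon> * k t" define w where "w = Z \<epsilon> t - Z 0 t"
        have bounds: "\<bar>p\<bar> \<le> \<bar>\<epsilon>\<bar> * H" "\<bar>q\<bar> \<le> \<bar>\<epsilon>\<bar> * K" "\<bar>\<epsilon> * \<zeta> t\<bar> \<le> \<bar>\<epsilon>\<bar> * W"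
          using H(2)[OF t] K(2)[OF t] W(2)[OF t] by (auto simp: p_def q_def abs_mult intro!: mult_left_mono)
        have w: "w = r t + \<epsilon> * \<zeta> t" by (simp add: w_def r_def)
        have wb: "\<bar>w\<bar> \<le> \<bar>r t\<bar> + \<bar>\<epsilon>\<bar> * W"
          using bounds(3) abs_triangle_ineq[of "r t" "\<epsilon> * \<zeta> t"] w by linarith
        have small: "\<bar>p\<bar> \<le> \<delta>" "\<bar>q\<bar> \<le> \<delta>" "\<bar>w\<bar> \<le> \<delta>"
          using bounds eB[of H] eB[of K] eB[of W] H(1) K(1) W(1) \<delta>(1) rt wb by (auto simp: N_def)
        define R where "R = L (t, x t + p, v t + q, Z 0 t + w) - L (t, x t, v t, Z 0 t) - (p2 t * p + p3 t * q + p4 t * w)"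
        have R: "\<bar>R\<bar> \<le> \<eta> * (\<bar>p\<bar> + \<bar>q\<bar> + \<bar>w\<bar>)" unfolding R_def by (rule \<delta>(2)[OF t small])
        \<comment> \<open>The equation of \<zeta> cancels the terms in \<open>p\<close> and
          \<open>q\<close>; of the term in \<open>w\<close> only the part coming from
          \<open>w - \<epsilon> * \<zeta> t = r t\<close> survives.\<close>
        have "r' t = p4 t * r t + R"
          by (simp add: r'_def R_def p_def q_def w_def r_def algebra_simps)
        then have "\<bar>r' t\<bar> \<le> Q * \<bar>r t\<bar> + \<bar>R\<bar>"
          using Q(2)[OF t] abs_triangle_ineq[of "p4 t * r t" R] mult_right_mono[of "\<bar>p4 t\<bar>" Q "\<bar>r t\<bar>"]
          by (auto simp: abs_mult)
        also have "\<bar>R\<bar> \<le> \<eta> * (\<bar>\<epsilon>\<bar> * (H + K + W) + \<bar>r t\<bar>)"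
        proof (rule order_trans[OF R mult_left_mono])
          show "\<bar>p\<bar> + \<bar>q\<bar> + \<bar>w\<bar> \<le> \<bar>\<epsilon>\<bar> * (H + K + W) + \<bar>r t\<bar>"
            using bounds wb by (simp add: algebra_simps)
        qed (use \<eta> in simp)
        also have "\<dots> < \<eta> * (\<bar>\<epsilon>\<bar> * N + \<bar>r t\<bar>)"
          using \<eta>(1) e by (simp add: N_def)
        finally show "\<bar>r' t\<bar> < \<eta> * \<bar>\<epsilon>\<bar> * N + (Q + \<eta>) * \<bar>r t\<bar>"
          by (simp add: algebra_simps)
      qed
      also have "\<dots> \<le> \<eta> * \<bar>\<epsilon>\<bar> * N * exp ((Q + 2) * (b - a))"
        using \<eta> N ab by (intro mult_left_mono) (auto intro!: mult_right_mono)
      finally show "\<bar>Z \<epsilon> T - Z 0 T - \<epsilon> * \<zeta> T\<bar> \<le> \<eta> * C * \<bar>\<epsilon>\<bar>"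
        by (simp add: r_def C_def algebra_simps)
    qed
  qed
  have "((\<lambda>\<epsilon>. Z \<epsilon> T) has_real_derivative \<zeta> T) (at 0)"
    unfolding DERIV_def LIM_def
  proof (intro allI impI)
    fix e :: real assume e: "e > 0"
    define \<eta> where "\<eta> = min 1 (e / (2 * C))"
    have \<eta>: "\<eta> > 0" "\<eta> \<le> 1" "\<eta> * C < e" using e C by (auto simp: \<eta>_def min_def field_simps)
    obtain s where s: "s > 0" "\<And>\<epsilon>. \<epsilon> \<noteq> 0 \<Longrightarrow> \<bar>\<epsilon>\<bar> < s \<Longrightarrow> \<bar>Z \<epsilon> T - Z 0 T - \<epsilon> * \<zeta> T\<bar> \<le> \<eta> * C * \<bar>\<epsilon>\<bar>"
      using est[OF \<eta>(1,2)] by blast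
    show "\<exists>s>0. \<forall>xa. xa \<noteq> 0 \<and> dist xa 0 < s \<longrightarrow> dist ((Z (0 + xa) T - Z 0 T) / xa) (\<zeta> T) < e"
    proof (intro exI[of _ s] conjI allI impI s(1))
      fix \<epsilon> :: real assume A: "\<epsilon> \<noteq> 0 \<and> dist \<epsilon> 0 < s"
      have "dist ((Z (0 + \<epsilon>) T - Z 0 T) / \<epsilon>) (\<zeta> T) = \<bar>(Z \<epsilon> T - Z 0 T - \<epsilon> * \<zeta> T) / \<epsilon>\<bar>"
        using A by (simp add: dist_real_def diff_divide_distrib)
      also have "\<dots> = \<bar>Z \<epsilon> T - Z 0 T - \<epsilon> * \<zeta> T\<bar> / \<bar>\<epsilon>\<bar>" by (rule abs_divide)
      also have "\<dots> \<le> \<eta> * C" using s(2)[of \<epsilon>] A by (simp add: pos_divide_le_eq)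
      finally show "dist ((Z (0 + \<epsilon>) T - Z 0 T) / \<epsilon>) (\<zeta> T) < e" using \<eta>(3) by linarith
    qed
  qed
  moreover have "J T = integral {a..T} (\<lambda>t. \<mu> t * (p2 t * h t + p3 t * k t))"
    unfolding J_def using T by (intro Henstock_Kurzweil_Integration.integral_cong) (simp add: m\<mu>)
  ultimately show ?thesis
    using m\<mu>[OF T] by (simp add: \<zeta>_def p2_def p3_def)
qed

subsection \<open>Weakly singular kernels of variable order\<close>

text \<open>As \<open>0 powr y = 0\<close>, the kernel takes the value 0 at its singularity
  \<open>s = 0\<close>.\<close>

definition rl_kernel :: "real \<Rightarrow> real \<Rightarrow> real" where
  "rl_kernel e s = s powr (- e) / Gamma (1 - e)"

text \<open>The reciprocal Gamma function is continuous on the whole line, so this form yields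
  measurability, continuity in the order and bounds without excluding poles.\<close>

lemma rl_kernel_rGamma: "rl_kernel e s = s powr (- e) * rGamma (1 - e)"
  by (simp add: rl_kernel_def rGamma_inverse_Gamma field_simps)

lemma rl_kernel_0 [simp]: "rl_kernel e 0 = 0"
  by (simp add: rl_kernel_def)

lemma borel_measurable_rl_kernel [measurable]:
  assumes [measurable]: "e \<in> borel_measurable M" "f \<in> borel_measurable M"
  shows "(\<lambda>x. rl_kernel (e x) (f x)) \<in> borel_measurable M"
proof -
  have [measurable]: "rGamma \<in> borel_measurable (borel :: real measure)"
    by (intro borel_measurable_continuous_onI continuous_on_rGamma)
  show ?thesis unfolding rl_kernel_rGamma by measurable
qed

lemma isCont_rl_kernel: "s \<ge> 0 \<Longrightarrow> isCont e t \<Longrightarrow> isCont (\<lambda>t. rl_kernel (e t) s) t"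
  by (cases "s = 0") (auto simp: rl_kernel_rGamma intro!: continuous_intros)

text \<open>A single power dominates the kernels of all orders up to \<open>A\<close> at once; it is
  integrable as long as \<open>A < 1\<close>.\<close>

definition rl_majorant :: "real \<Rightarrow> real \<Rightarrow> real \<Rightarrow> real" where
  "rl_majorant A l s = indicator {0..l} s * s powr (- A)"

lemma rl_majorant_nonneg: "rl_majorant A l s \<ge> 0"
  by (simp add: rl_majorant_def)

lemma integrable_rl_majorant:
  assumes "A < 1" "l \<ge> 0"
  shows "integrable lborel (rl_majorant A l)"
proof -
  have "set_integrable lebesgue {0..l} (\<lambda>s. s powr (- A))"
    using assms by (intro nonnegative_absolutely_integrable_1 integrable_on_powr_from_0) auto
  then have "set_integrable lborel {0..l} (\<lambda>s. s powr (- A))"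
    unfolding set_integrable_def by (subst (asm) integrable_completion) auto
  then show ?thesis by (simp add: set_integrable_def rl_majorant_def[abs_def])
qed

text \<open>Split \<open>s powr (- e) = s powr (A - e) * s powr (- A)\<close>. As
  \<open>0 \<le> A - e \<le> 1\<close>, the first factor is at most \<open>1 + l\<close>, and the
  reciprocal Gamma function is bounded on the unit interval.\<close>

lemma rl_kernel_le_majorant:
  assumes "A < 1" "l \<ge> 0"
  obtains C where "C \<ge> 0"
    "\<And>e s. e \<in> {0<..A} \<Longrightarrow> s \<in> {0..l} \<Longrightarrow> \<bar>rl_kernel e s\<bar> \<le> C * rl_majorant A l s"
proof -
  obtain B where B: "B \<ge> 0" "\<And>x. x \<in> {0..1::real} \<Longrightarrow> norm (rGamma x) \<le> B"
    using continuous_on_compact_bound[OF compact_Icc continuous_on_rGamma] by blast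
  show thesis
  proof (rule that[of "(1 + l) * B"])
    show "(1 + l) * B \<ge> 0" using assms B by simp
    fix e s assume e: "e \<in> {0<..A}" and s: "s \<in> {0..l}"
    show "\<bar>rl_kernel e s\<bar> \<le> (1 + l) * B * rl_majorant A l s"
    proof (cases "s = 0")
      case False
      then have s': "s > 0" using s by auto
      have "s powr (A - e) \<le> (1 + l) powr (A - e)"
        using s' s e by (intro powr_mono2) auto
      also have "\<dots> \<le> (1 + l) powr 1"
        using e assms by (intro powr_mono) auto
      finally have 1: "s powr (A - e) \<le> 1 + l" using assms by simp
      have "s powr (- e) = s powr (A - e) * s powr (- A)"
        by (simp add: powr_add[symmetric])
      also have "\<dots> \<le> (1 + l) * s powr (- A)"
        using 1 by (intro mult_right_mono) auto
      finally have "s powr (- e) * \<bar>rGamma (1 - e)\<bar> \<le> (1 + l) * s powr (- A) * B"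
        using B(2)[of "1 - e"] e assms by (intro mult_mono) auto
      then show ?thesis using s by (simp add: rl_kernel_rGamma abs_mult rl_majorant_def mult_ac)
    qed (use assms B in \<open>simp add: rl_majorant_def\<close>)
  qed
qed

definition clip :: "real \<Rightarrow> real \<Rightarrow> real \<Rightarrow> real" where
  "clip a b t = max a (min b t)"

lemma clip_mem: "a \<le> b \<Longrightarrow> clip a b t \<in> {a..b}"
  by (auto simp: clip_def)

lemma clip_id [simp]: "t \<in> {a..b} \<Longrightarrow> clip a b t = t"
  by (auto simp: clip_def)

lemma continuous_on_clip [continuous_intros]:
  "continuous_on S f \<Longrightarrow> continuous_on S (\<lambda>x. clip a b (f x))"
  unfolding clip_def by (intro continuous_intros)

text \<open>Orders and functions are extended from the interval by clipping the arguments, which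
  makes all integrands Borel measurable on the whole line.\<close>

locale variable_order =
  fixes a b A :: real and d :: "real \<Rightarrow> real \<Rightarrow> real"
  assumes ab: "a < b" and A: "A < 1"
    and d_cont: "continuous_on ({a..b} \<times> {a..b}) (\<lambda>(s, \<tau>). d s \<tau>)"
    and d_range: "\<And>s \<tau>. s \<in> {a..b} \<Longrightarrow> \<tau> \<in> {a..b} \<Longrightarrow> d s \<tau> \<in> {0<..A}"
begin

definition D :: "real \<Rightarrow> real \<Rightarrow> real" where
  "D s \<tau> = d (clip a b s) (clip a b \<tau>)"

lemma D_eq: "s \<in> {a..b} \<Longrightarrow> \<tau> \<in> {a..b} \<Longrightarrow> D s \<tau> = d s \<tau>"
  by (simp add: D_def)

lemma D_range: "D s \<tau> \<in> {0<..A}"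
  unfolding D_def using ab by (intro d_range clip_mem) auto

lemma continuous_on_D: "continuous_on UNIV (\<lambda>p. D (fst p) (snd p))"
proof -
  have "continuous_on UNIV (\<lambda>p. (\<lambda>(s, \<tau>). d s \<tau>) (clip a b (fst p), clip a b (snd p)))"
    using ab by (intro continuous_on_compose2[OF d_cont] continuous_intros) (auto simp: clip_def)
  then show ?thesis by (simp add: D_def)
qed

lemma isCont_D: "isCont u t \<Longrightarrow> isCont v t \<Longrightarrow> isCont (\<lambda>t. D (u t) (v t)) t"
  using continuous_on_D isCont_o2[of t "\<lambda>t. (u t, v t)" "\<lambda>p. D (fst p) (snd p)"]
  by (simp add: continuous_on_eq_continuous_within continuous_Pair)

lemma borel_measurable_D [measurable]:
  assumes [measurable]: "u \<in> borel_measurable M" "v \<in> borel_measurable M"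
  shows "(\<lambda>x. D (u x) (v x)) \<in> borel_measurable M"
  using borel_measurable_continuous_on[OF continuous_on_D, of "\<lambda>x. (u x, v x)" M] by simp

text \<open>The later time always comes first. The left integral integrates over the second argument
  and the right integral over the first, so exchanging integrations turns one into the
  other.\<close>

definition ker :: "real \<Rightarrow> real \<Rightarrow> real" where
  "ker t \<tau> = (if \<tau> \<le> t then rl_kernel (D t \<tau>) (t - \<tau>) else 0)"

lemma borel_measurable_ker [measurable]:
  assumes [measurable]: "u \<in> borel_measurable M" "v \<in> borel_measurable M"
  shows "(\<lambda>x. ker (u x) (v x)) \<in> borel_measurable M"
  unfolding ker_def by measurable

text \<open>The half-line \<open>S\<close> encodes the base point, so that fractional integrals with
  any base point become integrals over the whole line.\<close>

definition extend :: "real set \<Rightarrow> (real \<Rightarrow> real) \<Rightarrow> real \<Rightarrow> real" where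
  "extend S f \<tau> = indicator (S \<inter> {a..b}) \<tau> * f (clip a b \<tau>)"

lemma extend_outside: "\<tau> \<notin> {a..b} \<Longrightarrow> extend S f \<tau> = 0"
  by (auto simp: extend_def)

lemma extend_measurable [measurable]:
  assumes "S \<in> sets borel" "continuous_on {a..b} f"
  shows "extend S f \<in> borel_measurable borel"
proof -
  have "continuous_on UNIV (\<lambda>\<tau>. f (clip a b \<tau>))"
    using ab by (intro continuous_on_compose2[OF assms(2)] continuous_intros) (auto simp: clip_def)
  then have [measurable]: "(\<lambda>\<tau>. f (clip a b \<tau>)) \<in> borel_measurable borel"
    by (rule borel_measurable_continuous_onI)
  note [measurable] = assms(1)
  show ?thesis unfolding extend_def[abs_def] by measurable
qed

text \<open>The cutoff to the interval jumps only at its two ends, a null set, which is harmless for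
  dominated convergence.\<close>

lemma isCont_extend:
  assumes "continuous_on {a..b} f" "\<tau> \<notin> {a, b}"
  shows "isCont (extend UNIV f) \<tau>"
proof -
  have "continuous_on UNIV (\<lambda>\<tau>. f (clip a b \<tau>))"
    using ab by (intro continuous_on_compose2[OF assms(1)] continuous_intros) (auto simp: clip_def)
  then have "isCont (\<lambda>\<tau>. f (clip a b \<tau>)) \<tau>"
    by (simp add: continuous_on_eq_continuous_within)
  moreover have "isCont (indicator {a..b} :: real \<Rightarrow> real) \<tau>"
    using assms(2) by (subst isCont_indicator) (auto simp: frontier_def)
  ultimately show ?thesis
    unfolding extend_def[abs_def] by (intro isCont_mult) auto
qed

lemma extend_bound:
  assumes "continuous_on {a..b} f"
  obtains M where "M \<ge> 0" "\<And>S \<tau>. \<bar>extend S f \<tau>\<bar> \<le> M"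
proof -
  obtain M where M: "M \<ge> 0" "\<And>t. t \<in> {a..b} \<Longrightarrow> norm (f t) \<le> M"
    using continuous_on_compact_bound[OF compact_Icc assms] by blast
  show thesis
    by (rule that[OF M(1)]) (use M ab in \<open>auto simp: extend_def indicator_def clip_mem\<close>)
qed

section \<open>Integrals over the line and a common integrable bound\<close>

lemma RL_int_left_eq:
  assumes "c \<in> {a..b}" "t \<in> {a..b}"
  shows "RL_int_left d c f t = (LINT \<tau>|lborel. ker t \<tau> * extend {c..} f \<tau>)"
  unfolding RL_int_left_def set_lebesgue_integral_def using assms
  by (intro Bochner_Integration.integral_cong)
    (auto simp: ker_def extend_def indicator_def D_eq rl_kernel_def)

lemma RL_int_right_eq:
  assumes "c \<in> {a..b}" "t \<in> {a..b}"
  shows "RL_int_right d c f t = (LINT \<tau>|lborel. ker \<tau> t * extend {..c} f \<tau>)"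
  unfolding RL_int_right_def set_lebesgue_integral_def using assms
  by (intro Bochner_Integration.integral_cong)
    (auto simp: ker_def extend_def indicator_def D_eq rl_kernel_def)

text \<open>Fixing one constant by choice makes \<open>ker_bound\<close> a function of the distance
  alone, so its translates dominate every kernel section.\<close>

definition majorant_const :: real where
  "majorant_const = (SOME C. C \<ge> 0 \<and> (\<forall>e s. e \<in> {0<..A} \<longrightarrow> s \<in> {0..b - a} \<longrightarrow>
      \<bar>rl_kernel e s\<bar> \<le> C * rl_majorant A (b - a) s))"

definition ker_bound :: "real \<Rightarrow> real" where
  "ker_bound s = majorant_const * rl_majorant A (b - a) s"

lemma ker_bound_nonneg: "ker_bound s \<ge> 0"
  and rl_kernel_le_ker_bound: "e \<in> {0<..A} \<Longrightarrow> s \<in> {0..b - a} \<Longrightarrow> \<bar>rl_kernel e s\<bar> \<le> ker_bound s"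
proof -
  have "\<exists>C. C \<ge> 0 \<and> (\<forall>e s. e \<in> {0<..A} \<longrightarrow> s \<in> {0..b - a} \<longrightarrow>
      \<bar>rl_kernel e s\<bar> \<le> C * rl_majorant A (b - a) s)"
    using rl_kernel_le_majorant[OF A, of "b - a"] ab by (metis diff_ge_0_iff_ge less_imp_le)
  from someI_ex[OF this] have *: "majorant_const \<ge> 0 \<and> (\<forall>e s. e \<in> {0<..A} \<longrightarrow> s \<in> {0..b - a} \<longrightarrow>
      \<bar>rl_kernel e s\<bar> \<le> majorant_const * rl_majorant A (b - a) s)"
    unfolding majorant_const_def .
  show "ker_bound s \<ge> 0" using * rl_majorant_nonneg unfolding ker_bound_def by (intro mult_nonneg_nonneg) auto
  show "\<bar>rl_kernel e s\<bar> \<le> ker_bound s" if "e \<in> {0<..A}" "s \<in> {0..b - a}" using * that by (simp add: ker_bound_def)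
qed

lemma integrable_ker_bound: "integrable lborel ker_bound"
  unfolding ker_bound_def[abs_def] using integrable_rl_majorant[OF A] ab by (intro integrable_mult_right) auto

lemma ker_bound_measurable [measurable]: "ker_bound \<in> borel_measurable borel"
  using integrable_ker_bound by (simp add: borel_measurable_integrable)

lemma ker_le_bound: "t \<in> {a..b} \<Longrightarrow> \<tau> \<in> {a..b} \<Longrightarrow> \<bar>ker t \<tau>\<bar> \<le> ker_bound (t - \<tau>)"
  unfolding ker_def using rl_kernel_le_ker_bound[OF D_range, of "t - \<tau>" t \<tau>] ker_bound_nonneg by auto

lemma integrable_ker_left:
  assumes t: "t \<in> {a..b}" and f: "continuous_on {a..b} f" and S: "S \<in> sets borel"
  shows "integrable lborel (\<lambda>\<tau>. ker t \<tau> * extend S f \<tau>)"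
proof -
  obtain M where M: "M \<ge> 0" "\<And>S \<tau>. \<bar>extend S f \<tau>\<bar> \<le> M" using extend_bound[OF f] by blast
  have "integrable lborel (\<lambda>\<tau>. ker_bound (t + (-1) * \<tau>) * M)"
    by (intro integrable_mult_left lborel_integrable_real_affine integrable_ker_bound) auto
  then show ?thesis
  proof (rule Bochner_Integration.integrable_bound)
    note [measurable] = extend_measurable[OF S f]
    show "(\<lambda>\<tau>. ker t \<tau> * extend S f \<tau>) \<in> borel_measurable lborel" by measurable
    show "AE \<tau> in lborel. norm (ker t \<tau> * extend S f \<tau>) \<le> norm (ker_bound (t + - 1 * \<tau>) * M)"
    proof (rule AE_I2)
      fix \<tau> show "norm (ker t \<tau> * extend S f \<tau>) \<le> norm (ker_bound (t + - 1 * \<tau>) * M)"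
        by (cases "\<tau> \<in> {a..b}")
          (auto simp: abs_mult extend_outside abs_of_nonneg[OF M(1)] M(1) intro!: mult_mono ker_le_bound[OF t, THEN order_trans] M(2))
    qed
  qed
qed

lemma integrable_ker_right:
  assumes t: "t \<in> {a..b}" and f: "continuous_on {a..b} f" and S: "S \<in> sets borel"
  shows "integrable lborel (\<lambda>\<tau>. ker \<tau> t * extend S f \<tau>)"
proof -
  obtain M where M: "M \<ge> 0" "\<And>S \<tau>. \<bar>extend S f \<tau>\<bar> \<le> M" using extend_bound[OF f] by blast
  have "integrable lborel (\<lambda>\<tau>. ker_bound (- t + 1 * \<tau>) * M)"
    by (intro integrable_mult_left lborel_integrable_real_affine integrable_ker_bound) auto
  then show ?thesis
  proof (rule Bochner_Integration.integrable_bound)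
    note [measurable] = extend_measurable[OF S f]
    show "(\<lambda>\<tau>. ker \<tau> t * extend S f \<tau>) \<in> borel_measurable lborel" by measurable
    show "AE \<tau> in lborel. norm (ker \<tau> t * extend S f \<tau>) \<le> norm (ker_bound (- t + 1 * \<tau>) * M)"
    proof (rule AE_I2)
      fix \<tau> show "norm (ker \<tau> t * extend S f \<tau>) \<le> norm (ker_bound (- t + 1 * \<tau>) * M)"
        by (cases "\<tau> \<in> {a..b}")
          (auto simp: abs_mult extend_outside abs_of_nonneg[OF M(1)] M(1) intro!: mult_mono ker_le_bound[OF _ t, THEN order_trans] M(2))
    qed
  qed
qed

lemma extend_add_mult: "extend S (\<lambda>\<tau>. f \<tau> + \<epsilon> * h \<tau>) \<tau> = extend S f \<tau> + \<epsilon> * extend S h \<tau>"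
  by (simp add: extend_def algebra_simps)

lemma RL_int_left_add_mult:
  assumes "c \<in> {a..b}" "t \<in> {a..b}" "continuous_on {a..b} f" "continuous_on {a..b} h"
  shows "RL_int_left d c (\<lambda>\<tau>. f \<tau> + \<epsilon> * h \<tau>) t = RL_int_left d c f t + \<epsilon> * RL_int_left d c h t"
  using integrable_ker_left[OF assms(2,3), of "{c..}"] integrable_ker_left[OF assms(2,4), of "{c..}"]
  by (simp add: RL_int_left_eq[OF assms(1,2)] extend_add_mult distrib_left mult.left_commute[of _ \<epsilon>])

lemma RL_int_right_add_mult:
  assumes "c \<in> {a..b}" "t \<in> {a..b}" "continuous_on {a..b} f" "continuous_on {a..b} h"
  shows "RL_int_right d c (\<lambda>\<tau>. f \<tau> + \<epsilon> * h \<tau>) t = RL_int_right d c f t + \<epsilon> * RL_int_right d c h t"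
  using integrable_ker_right[OF assms(2,3), of "{..c}"] integrable_ker_right[OF assms(2,4), of "{..c}"]
  by (simp add: RL_int_right_eq[OF assms(1,2)] extend_add_mult distrib_left mult.left_commute[of _ \<epsilon>])

text \<open>With the distance \<open>s\<close> from \<open>t\<close> as integration variable, the
  singularity sits at \<open>s = 0\<close> for all \<open>t\<close>, and one dominating function
  works throughout. The sign \<sigma> is -1 for left and 1 for right integrals.\<close>

lemma continuous_on_kernel_integral:
  assumes f: "continuous_on {a..b} f" and \<sigma>: "\<sigma> \<in> {1, -1}"
    and e: "\<And>s t. isCont (\<lambda>t. e t s) t" and e_range: "\<And>t s. e t s \<in> {0<..A}"
    and [measurable]: "\<And>t. e t \<in> borel_measurable borel"
  shows "continuous_on {a..b}
    (\<lambda>t. LINT s|lborel. (if 0 \<le> s then rl_kernel (e t s) s else 0) * extend UNIV f (t + \<sigma> * s))"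
proof -
  obtain M where M: "M \<ge> 0" "\<And>S \<tau>. \<bar>extend S f \<tau>\<bar> \<le> M" using extend_bound[OF f] by blast
  note [measurable] = extend_measurable[OF _ f]
  show ?thesis
    unfolding continuous_on_sequentially o_def
  proof (intro allI ballI impI, elim conjE)
    fix u t assume t: "t \<in> {a..b}" and u: "\<forall>n. u n \<in> {a..b}" and lim: "u \<longlonglongrightarrow> t"
    let ?I = "\<lambda>t s. (if 0 \<le> s then rl_kernel (e t s) s else 0) * extend UNIV f (t + \<sigma> * s)"
    show "(\<lambda>n. LINT s|lborel. ?I (u n) s) \<longlonglongrightarrow> (LINT s|lborel. ?I t s)"
    proof (rule integral_dominated_convergence[where w = "\<lambda>s. ker_bound s * M"])
      show "integrable lborel (\<lambda>s. ker_bound s * M)" using integrable_ker_bound by simp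
      show "AE s in lborel. (\<lambda>n. ?I (u n) s) \<longlonglongrightarrow> ?I t s"
      proof -
        \<comment> \<open>The two excluded distances are those at which
          \<open>t + \<sigma> * s\<close> hits an end of the interval, where the extended function
          may jump.\<close>
        have "AE s in lborel. s \<noteq> (a - t) / \<sigma>" "AE s in lborel. s \<noteq> (b - t) / \<sigma>"
          by (rule AE_lborel_singleton)+
        then show ?thesis
        proof eventually_elim
          case (elim s)
          have "t + \<sigma> * s \<notin> {a, b}" using elim \<sigma> by (auto simp: field_simps)
          then have "isCont (extend UNIV f) (t + \<sigma> * s)" by (rule isCont_extend[OF f])
          moreover have "isCont (\<lambda>t. t + \<sigma> * s) t" by simp
          ultimately have "isCont (\<lambda>t. extend UNIV f (t + \<sigma> * s)) t"
            by (rule isCont_o2[rotated])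
          moreover have "isCont (\<lambda>t. if 0 \<le> s then rl_kernel (e t s) s else 0) t"
            using isCont_rl_kernel[OF _ e] by (cases "0 \<le> s") auto
          ultimately have "isCont (\<lambda>t. ?I t s) t" by (rule isCont_mult[rotated])
          then show ?case using lim by (rule isCont_tendsto_compose)
        qed
      qed
      show "AE s in lborel. norm (?I (u n) s) \<le> ker_bound s * M" for n
      proof (rule AE_I2)
        fix s
        have un: "u n \<in> {a..b}" using u by blast
        show "norm (?I (u n) s) \<le> ker_bound s * M"
        proof (cases "0 \<le> s \<and> u n + \<sigma> * s \<in> {a..b}")
          case True
          then have "s \<in> {0..b - a}" using \<sigma> un by auto
          then have "\<bar>rl_kernel (e (u n) s) s\<bar> \<le> ker_bound s" by (rule rl_kernel_le_ker_bound[OF e_range])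
          then show ?thesis using True M ker_bound_nonneg by (auto simp: abs_mult intro!: mult_mono)
        next
          case False
          then have "?I (u n) s = 0" using extend_outside by auto
          then show ?thesis using M(1) ker_bound_nonneg[of s] by (simp only: norm_zero mult_nonneg_nonneg)
        qed
      qed
    qed measurable
  qed
qed

lemma continuous_on_RL_int_left:
  assumes f: "continuous_on {a..b} f"
  shows "continuous_on {a..b} (RL_int_left d a f)"
proof -
  have "RL_int_left d a f t =
      (LINT s|lborel. (if 0 \<le> s then rl_kernel (D t (t - s)) s else 0) * extend UNIV f (t + (-1) * s))"
    if t: "t \<in> {a..b}" for t
  proof -
    have "extend {a..} f = extend UNIV f" by (auto simp: extend_def indicator_def fun_eq_iff)
    then have "RL_int_left d a f t = (LINT \<tau>|lborel. ker t \<tau> * extend UNIV f \<tau>)"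
      using RL_int_left_eq[OF _ t, of a f] ab by simp
    also have "\<dots> = (LINT s|lborel. ker t (t + (-1) * s) * extend UNIV f (t + (-1) * s))"
      by (subst lborel_integral_real_affine[where c = "-1" and t = t]) auto
    also have "\<dots> = (LINT s|lborel. (if 0 \<le> s then rl_kernel (D t (t - s)) s else 0) * extend UNIV f (t + (-1) * s))"
      by (intro Bochner_Integration.integral_cong) (auto simp: ker_def)
    finally show ?thesis .
  qed
  moreover have "continuous_on {a..b}
      (\<lambda>t. LINT s|lborel. (if 0 \<le> s then rl_kernel (D t (t - s)) s else 0) * extend UNIV f (t + (-1) * s))"
    by (intro continuous_on_kernel_integral f D_range isCont_D continuous_intros) auto
  ultimately show ?thesis by (metis (lifting) continuous_on_eq)
qed

lemma continuous_on_RL_int_right: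
  assumes f: "continuous_on {a..b} f"
  shows "continuous_on {a..b} (RL_int_right d b f)"
proof -
  have "RL_int_right d b f t =
      (LINT s|lborel. (if 0 \<le> s then rl_kernel (D (t + s) t) s else 0) * extend UNIV f (t + 1 * s))"
    if t: "t \<in> {a..b}" for t
  proof -
    have "extend {..b} f = extend UNIV f" by (auto simp: extend_def indicator_def fun_eq_iff)
    then have "RL_int_right d b f t = (LINT \<tau>|lborel. ker \<tau> t * extend UNIV f \<tau>)"
      using RL_int_right_eq[OF _ t, of b f] ab by simp
    also have "\<dots> = (LINT s|lborel. ker (t + 1 * s) t * extend UNIV f (t + 1 * s))"
      by (subst lborel_integral_real_affine[where c = 1 and t = t]) auto
    also have "\<dots> = (LINT s|lborel. (if 0 \<le> s then rl_kernel (D (t + s) t) s else 0) * extend UNIV f (t + 1 * s))"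
      by (intro Bochner_Integration.integral_cong) (auto simp: ker_def)
    finally show ?thesis .
  qed
  moreover have "continuous_on {a..b}
      (\<lambda>t. LINT s|lborel. (if 0 \<le> s then rl_kernel (D (t + s) t) s else 0) * extend UNIV f (t + 1 * s))"
    by (intro continuous_on_kernel_integral f D_range isCont_D continuous_intros) auto
  ultimately show ?thesis by (metis (lifting) continuous_on_eq)
qed

text \<open>This is the adjointness of left and right fractional integration. Absolute integrability
  holds because the inner integral of the absolute value is at most \<open>M * N\<close> times the
  integral of \<open>ker_bound\<close>, uniformly in \<open>t\<close>, and vanishes for
  \<open>t\<close> outside the interval.\<close>

lemma kernel_Fubini:
  assumes f: "continuous_on {a..b} f" and h: "continuous_on {a..b} h"
    and S: "S \<in> sets borel" and S': "S' \<in> sets borel"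
  shows "(LINT t|lborel. extend S f t * (LINT \<tau>|lborel. ker t \<tau> * extend S' h \<tau>))
    = (LINT \<tau>|lborel. extend S' h \<tau> * (LINT t|lborel. ker t \<tau> * extend S f t))"
proof -
  obtain M where M: "M \<ge> 0" "\<And>S \<tau>. \<bar>extend S f \<tau>\<bar> \<le> M" using extend_bound[OF f] by blast
  obtain N where N: "N \<ge> 0" "\<And>S \<tau>. \<bar>extend S h \<tau>\<bar> \<le> N" using extend_bound[OF h] by blast
  note [measurable] = extend_measurable[OF S f] extend_measurable[OF S' h]
  let ?F = "\<lambda>t \<tau>. extend S f t * (ker t \<tau> * extend S' h \<tau>)"
  have "integrable (lborel \<Otimes>\<^sub>M lborel) (case_prod ?F)"
  proof (rule lborel_pair.Fubini_integrable)
    show "case_prod ?F \<in> borel_measurable (lborel \<Otimes>\<^sub>M lborel)" by measurable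
    have int: "integrable lborel (?F t)" for t
    proof (cases "t \<in> {a..b}")
      case True
      then show ?thesis by (intro integrable_mult_right integrable_ker_left h S')
    qed (simp add: extend_outside)
    then show "AE t in lborel. integrable lborel (\<lambda>\<tau>. case (t, \<tau>) of (t, \<tau>) \<Rightarrow> ?F t \<tau>)"
      by simp
    have "integrable lborel (\<lambda>t. indicator {a..b} t * (M * N * (LINT s|lborel. ker_bound s)))"
      using ab by (intro integrable_mult_left integrable_real_indicator) (auto simp: emeasure_lborel_Icc)
    then show "integrable lborel (\<lambda>t. LINT \<tau>|lborel. norm (case (t, \<tau>) of (t, \<tau>) \<Rightarrow> ?F t \<tau>))"
    proof (rule Bochner_Integration.integrable_bound)
      show "(\<lambda>t. LINT \<tau>|lborel. norm (case (t, \<tau>) of (t, \<tau>) \<Rightarrow> ?F t \<tau>)) \<in> borel_measurable lborel"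
        by measurable
      show "AE t in lborel. norm (LINT \<tau>|lborel. norm (case (t, \<tau>) of (t, \<tau>) \<Rightarrow> ?F t \<tau>))
          \<le> norm (indicator {a..b} t * (M * N * (LINT s|lborel. ker_bound s)))"
      proof (rule AE_I2)
        fix t
        show "norm (LINT \<tau>|lborel. norm (case (t, \<tau>) of (t, \<tau>) \<Rightarrow> ?F t \<tau>))
          \<le> norm (indicator {a..b} t * (M * N * (LINT s|lborel. ker_bound s)))"
        proof (cases "t \<in> {a..b}")
          case True
          have "(LINT \<tau>|lborel. norm (?F t \<tau>)) \<le> (LINT \<tau>|lborel. M * N * ker_bound (t + (-1) * \<tau>))"
          proof (rule integral_mono)
            show "integrable lborel (\<lambda>\<tau>. norm (?F t \<tau>))" using int by simp
            show "integrable lborel (\<lambda>\<tau>. M * N * ker_bound (t + (-1) * \<tau>))"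
              by (intro integrable_mult_right lborel_integrable_real_affine integrable_ker_bound) auto
            fix \<tau>
            show "norm (?F t \<tau>) \<le> M * N * ker_bound (t + (-1) * \<tau>)"
            proof (cases "\<tau> \<in> {a..b}")
              case \<tau>: True
              have "norm (?F t \<tau>) = \<bar>extend S f t\<bar> * (\<bar>ker t \<tau>\<bar> * \<bar>extend S' h \<tau>\<bar>)" by (simp add: abs_mult)
              also have "\<dots> \<le> M * (ker_bound (t - \<tau>) * N)"
                using ker_le_bound[OF True \<tau>] ker_bound_nonneg M N by (intro mult_mono) auto
              finally show ?thesis by (simp add: mult_ac)
            qed (use M N ker_bound_nonneg in \<open>simp add: extend_outside\<close>)
          qed
          also have "\<dots> = M * N * (LINT s|lborel. ker_bound s)"
            by (subst (2) lborel_integral_real_affine[where c = "-1" and t = t]) auto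
          finally show ?thesis using True by (simp add: abs_of_nonneg[OF integral_nonneg])
        qed (simp add: extend_outside)
      qed
    qed
  qed
  have "(LINT t|lborel. ?F t \<tau>) = extend S' h \<tau> * (LINT t|lborel. ker t \<tau> * extend S f t)" for \<tau>
    by (subst integral_mult_right_zero[symmetric]) (simp add: mult_ac)
  with lborel_pair.Fubini_integral[OF \<open>integrable _ (case_prod ?F)\<close>] show ?thesis by simp
qed

end

text \<open>A continuous order attains its maximum on the compact square, and this maximum is still
  below 1. The uniform gap is what makes a common integrable majorant available.\<close>

lemma variable_orderI:
  assumes "a < b" and cont: "continuous_on ({a..b} \<times> {a..b}) (\<lambda>(s, \<tau>). d s \<tau>)"
    and range: "\<And>s \<tau>. s \<in> {a..b} \<Longrightarrow> \<tau> \<in> {a..b} \<Longrightarrow> d s \<tau> \<in> {0<..<1::real}"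
  obtains A where "variable_order a b A d"
proof -
  have "\<exists>p\<in>{a..b} \<times> {a..b}. \<forall>q\<in>{a..b} \<times> {a..b}. (\<lambda>(s, \<tau>). d s \<tau>) q \<le> (\<lambda>(s, \<tau>). d s \<tau>) p"
    using assms by (intro continuous_attains_sup compact_Times) auto
  then obtain s0 \<tau>0 where *: "s0 \<in> {a..b}" "\<tau>0 \<in> {a..b}"
    "\<And>s \<tau>. s \<in> {a..b} \<Longrightarrow> \<tau> \<in> {a..b} \<Longrightarrow> d s \<tau> \<le> d s0 \<tau>0"
    by fastforce
  have "variable_order a b (d s0 \<tau>0) d"
    using assms range[of s0 \<tau>0] range *
    by unfold_locales (auto simp: greaterThanLessThan_iff greaterThanAtMost_iff)
  then show thesis by (rule that)
qed

section \<open>Fractional integrals at and beyond the base point\<close>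

lemma RL_int_left_cong:
  "(\<And>\<tau>. \<tau> \<in> {c..t} \<Longrightarrow> f \<tau> = g \<tau>) \<Longrightarrow> RL_int_left d c f t = RL_int_left d c g t"
  unfolding RL_int_left_def by (rule set_lebesgue_integral_cong) auto

lemma RL_int_right_cong:
  "(\<And>\<tau>. \<tau> \<in> {t..c} \<Longrightarrow> f \<tau> = g \<tau>) \<Longrightarrow> RL_int_right d c f t = RL_int_right d c g t"
  unfolding RL_int_right_def by (rule set_lebesgue_integral_cong) auto

text \<open>The domain of integration is empty or the single point where the kernel is 0. Fractional
  integrals based at \<open>T\<close> thus extend by zero across \<open>T\<close>, which lets all
  terms of the first variation live on the same interval.\<close>

lemma RL_int_left_outside: "t \<le> c \<Longrightarrow> RL_int_left d c f t = 0"
  unfolding RL_int_left_def set_lebesgue_integral_def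
  by (rule integral_eq_zero_AE) (auto simp: indicator_def)

lemma RL_int_right_outside: "c \<le> t \<Longrightarrow> RL_int_right d c f t = 0"
  unfolding RL_int_right_def set_lebesgue_integral_def
  by (rule integral_eq_zero_AE) (auto simp: indicator_def)

lemma continuous_on_Icc_extend_right:
  fixes F :: "real \<Rightarrow> real"
  assumes "continuous_on {a..T} F" "\<And>t. T \<le> t \<Longrightarrow> F t = 0" "T \<in> {a..b}"
  shows "continuous_on {a..b} F"
proof -
  have "continuous_on {T..b} F" using assms(2) by (intro continuous_on_eq[OF continuous_on_const[of _ 0]]) auto
  then have "continuous_on ({a..T} \<union> {T..b}) F" using assms(1) by (intro continuous_on_closed_Un) auto
  then show ?thesis using assms(3) by (simp add: ivl_disj_un_two_touch)
qed

lemma continuous_on_Icc_extend_left: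
  fixes F :: "real \<Rightarrow> real"
  assumes "continuous_on {T..b} F" "\<And>t. t \<le> T \<Longrightarrow> F t = 0" "T \<in> {a..b}"
  shows "continuous_on {a..b} F"
proof -
  have "continuous_on {a..T} F" using assms(2) by (intro continuous_on_eq[OF continuous_on_const[of _ 0]]) auto
  then have "continuous_on ({a..T} \<union> {T..b}) F" using assms(1) by (intro continuous_on_closed_Un) auto
  then show ?thesis using assms(3) by (simp add: ivl_disj_un_two_touch)
qed

lemma lborel_integral_eq_integral:
  fixes F :: "real \<Rightarrow> real"
  assumes "continuous_on {c..e} F" "\<And>t. H t = indicator {c..e} t * F t"
  shows "(LINT t|lborel. H t) = integral {c..e} F"
  using set_borel_integral_eq_integral(2)[OF borel_integrable_atLeastAtMost'[OF assms(1)]] assms(2)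
  by (simp add: set_lebesgue_integral_def)

section \<open>Fractional integration by parts\<close>

context variable_order
begin

text \<open>Cutting \<open>f\<close> off beyond \<open>T\<close> makes the adjoint of the left
  integral a right integral based at \<open>T\<close>. That one vanishes after \<open>T\<close>, so
  the second integral may run up to \<open>b\<close>.\<close>

lemma RL_parts_left:
  assumes f: "continuous_on {a..b} f" and h: "continuous_on {a..b} h" and T: "T \<in> {a..b}"
    and R: "continuous_on {a..T} (RL_int_right d T f)"
  shows "integral {a..T} (\<lambda>t. f t * RL_int_left d a h t) = integral {a..b} (\<lambda>t. h t * RL_int_right d T f t)"
proof -
  have R': "continuous_on {a..b} (RL_int_right d T f)"
    by (rule continuous_on_Icc_extend_right[OF R _ T]) (rule RL_int_right_outside)
  have ext: "extend {a..} h = extend UNIV h" by (auto simp: extend_def indicator_def fun_eq_iff)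
  have "(LINT t|lborel. extend {..T} f t * (LINT \<tau>|lborel. ker t \<tau> * extend UNIV h \<tau>))
      = integral {a..T} (\<lambda>t. f t * RL_int_left d a h t)"
    using T ab
    by (intro lborel_integral_eq_integral continuous_intros continuous_on_subset[OF f]
          continuous_on_subset[OF continuous_on_RL_int_left[OF h]])
      (auto simp: extend_def[of "{..T}"] indicator_def RL_int_left_eq ext)
  moreover have "(LINT \<tau>|lborel. extend UNIV h \<tau> * (LINT t|lborel. ker t \<tau> * extend {..T} f t))
      = integral {a..b} (\<lambda>t. h t * RL_int_right d T f t)"
    using T by (intro lborel_integral_eq_integral continuous_intros h R')
      (auto simp: extend_def[of UNIV] indicator_def RL_int_right_eq)
  ultimately show ?thesis using kernel_Fubini[OF f h, of "{..T}" UNIV] by simp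
qed

lemma RL_int_left_diff:
  assumes f: "continuous_on {a..b} f" and T: "T \<in> {a..b}" and t: "t \<in> {a..b}"
  shows "(LINT \<tau>|lborel. ker t \<tau> * extend {..T} f \<tau>) = RL_int_left d a f t - RL_int_left d T f t"
proof -
  \<comment> \<open>The half-lines \<open>{..T}\<close> and \<open>{T..}\<close> share the point
    \<open>T\<close>; dropping this null set makes the splitting disjoint.\<close>
  have "(LINT \<tau>|lborel. ker t \<tau> * extend {T..} f \<tau>) = (LINT \<tau>|lborel. ker t \<tau> * extend {T<..} f \<tau>)"
  proof (rule integral_cong_AE)
    have [measurable]: "extend {T..} f \<in> borel_measurable borel" "extend {T<..} f \<in> borel_measurable borel"
      by (intro extend_measurable f; simp)+
    show "(\<lambda>\<tau>. ker t \<tau> * extend {T..} f \<tau>) \<in> borel_measurable lborel"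
      "(\<lambda>\<tau>. ker t \<tau> * extend {T<..} f \<tau>) \<in> borel_measurable lborel" by measurable
    show "AE \<tau> in lborel. ker t \<tau> * extend {T..} f \<tau> = ker t \<tau> * extend {T<..} f \<tau>"
      using AE_lborel_singleton[of T] by eventually_elim (auto simp: extend_def indicator_def)
  qed
  moreover have "(LINT \<tau>|lborel. ker t \<tau> * extend {a..} f \<tau>)
      = (LINT \<tau>|lborel. ker t \<tau> * extend {..T} f \<tau> + ker t \<tau> * extend {T<..} f \<tau>)"
    by (intro Bochner_Integration.integral_cong) (auto simp: extend_def indicator_def)
  moreover have "\<dots> = (LINT \<tau>|lborel. ker t \<tau> * extend {..T} f \<tau>) + (LINT \<tau>|lborel. ker t \<tau> * extend {T<..} f \<tau>)"
    by (intro Bochner_Integration.integral_add integrable_ker_left t f) auto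
  ultimately show ?thesis using T t ab by (simp add: RL_int_left_eq)
qed

text \<open>The right integral of \<open>h\<close> based at \<open>b\<close> looks beyond
  \<open>T\<close>, so its adjoint acts on all of \<open>{a..b}\<close>. It integrates
  \<open>f\<close> only up to \<open>T\<close>, whence the difference of left integrals. This is the
  source of the second equation, on \<open>{T..b}\<close>.\<close>

lemma RL_parts_right:
  assumes f: "continuous_on {a..b} f" and h: "continuous_on {a..b} h" and T: "T \<in> {a..b}"
    and R: "continuous_on {T..b} (RL_int_left d T f)"
  shows "integral {a..T} (\<lambda>t. f t * RL_int_right d b h t)
    = integral {a..b} (\<lambda>t. h t * (RL_int_left d a f t - RL_int_left d T f t))"
proof -
  have R': "continuous_on {a..b} (RL_int_left d T f)"
    by (rule continuous_on_Icc_extend_left[OF R _ T]) (rule RL_int_left_outside)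
  have ext: "extend {..b} h = extend UNIV h" by (auto simp: extend_def indicator_def fun_eq_iff)
  have "(LINT \<tau>|lborel. extend {..T} f \<tau> * (LINT t|lborel. ker t \<tau> * extend UNIV h t))
      = integral {a..T} (\<lambda>t. f t * RL_int_right d b h t)"
    using T ab
    by (intro lborel_integral_eq_integral continuous_intros continuous_on_subset[OF f]
          continuous_on_subset[OF continuous_on_RL_int_right[OF h]])
      (auto simp: extend_def[of "{..T}"] indicator_def RL_int_right_eq ext)
  moreover have "(LINT t|lborel. extend UNIV h t * (LINT \<tau>|lborel. ker t \<tau> * extend {..T} f \<tau>))
      = integral {a..b} (\<lambda>t. h t * (RL_int_left d a f t - RL_int_left d T f t))"
    using T by (intro lborel_integral_eq_integral continuous_intros h R' continuous_on_RL_int_left f)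
      (auto simp: extend_def[of UNIV] indicator_def RL_int_left_diff[OF f T])
  ultimately show ?thesis using kernel_Fubini[OF h f, of UNIV "{..T}"] by simp
qed

end

text \<open>Ordinary integration by parts; the boundary terms vanish since \<open>h a = 0\<close>
  and the primitive of \<psi> vanishes at \<open>T\<close>. That primitive is 0 beyond
  \<open>T\<close>, where its interval is degenerate, so the result may be written over
  \<open>{a..b}\<close>.\<close>

lemma integral_parts_primitive:
  fixes \<psi> h G :: "real \<Rightarrow> real"
  assumes \<psi>: "continuous_on {a..b} \<psi>" and G: "continuous_on {a..b} G" and T: "T \<in> {a..b}"
    and h: "\<And>t. h t = integral {a..t} G"
  shows "integral {a..T} (\<lambda>t. \<psi> t * h t) = integral {a..b} (\<lambda>t. G t * integral {t..T} \<psi>)"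
    and "continuous_on {a..b} (\<lambda>t. integral {t..T} \<psi>)"
proof -
  have \<psi>': "continuous_on {a..T} \<psi>" and G': "continuous_on {a..T} G"
    using T by (auto intro: continuous_on_subset[OF \<psi>] continuous_on_subset[OF G])
  have h': "(h has_real_derivative G t) (at t within {a..T})" if "t \<in> {a..T}" for t
    unfolding h[abs_def] by (rule integral_has_real_derivative[OF G' that])
  have M': "((\<lambda>t. integral {t..T} \<psi>) has_real_derivative - \<psi> t) (at t within {a..T})" if "t \<in> {a..T}" for t
    by (rule integral_has_real_derivative'[OF \<psi>' that])
  have hc: "continuous_on {a..T} h"
    using h' by (meson DERIV_continuous continuous_on_eq_continuous_within)
  have M'c: "continuous_on {a..T} (\<lambda>t. integral {t..T} \<psi>)"
    using M' by (meson DERIV_continuous continuous_on_eq_continuous_within)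
  have M0: "integral {t..T} \<psi> = 0" if "T \<le> t" for t
    using that by (cases "t = T") auto
  show Mc: "continuous_on {a..b} (\<lambda>t. integral {t..T} \<psi>)"
    by (rule continuous_on_Icc_extend_right[OF M'c M0 T])
  have "((\<lambda>t. G t * integral {t..T} \<psi> - \<psi> t * h t) has_integral
      h T * integral {T..T} \<psi> - h a * integral {a..T} \<psi>) {a..T}"
  proof (rule fundamental_theorem_of_calculus)
    fix t assume t: "t \<in> {a..T}"
    have "((\<lambda>t. h t * integral {t..T} \<psi>) has_real_derivative G t * integral {t..T} \<psi> + (- \<psi> t) * h t) (at t within {a..T})"
      by (rule DERIV_mult[OF h'[OF t] M'[OF t]])
    then show "((\<lambda>t. h t * integral {t..T} \<psi>) has_vector_derivative G t * integral {t..T} \<psi> - \<psi> t * h t) (at t within {a..T})"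
      by (simp add: has_real_derivative_iff_has_vector_derivative)
  qed (use T in auto)
  then have "integral {a..T} (\<lambda>t. G t * integral {t..T} \<psi> - \<psi> t * h t) = 0"
    by (simp add: h integral_unique)
  moreover have "(\<lambda>t. G t * integral {t..T} \<psi>) integrable_on {a..T}" "(\<lambda>t. \<psi> t * h t) integrable_on {a..T}"
    by (intro integrable_continuous_real continuous_intros G' M'c \<psi>' hc)+
  ultimately have "integral {a..T} (\<lambda>t. \<psi> t * h t) = integral {a..T} (\<lambda>t. G t * integral {t..T} \<psi>)"
    by (simp add: Henstock_Kurzweil_Integration.integral_diff)
  also have "\<dots> = integral {a..T} (\<lambda>t. G t * integral {t..T} \<psi>) + integral {T..b} (\<lambda>t. G t * integral {t..T} \<psi>)"
  proof -
    have "integral {T..b} (\<lambda>t. G t * integral {t..T} \<psi>) = integral {T..b} (\<lambda>t. 0)"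
      by (intro Henstock_Kurzweil_Integration.integral_cong) (simp add: M0)
    then show ?thesis by simp
  qed
  also have "\<dots> = integral {a..b} (\<lambda>t. G t * integral {t..T} \<psi>)"
    using T by (intro Henstock_Kurzweil_Integration.integral_combine integrable_continuous_real continuous_intros G Mc) auto
  finally show "integral {a..T} (\<lambda>t. \<psi> t * h t) = integral {a..b} (\<lambda>t. G t * integral {t..T} \<psi>)" .
qed

lemma zero_function_derivative:
  fixes F :: "real \<Rightarrow> real"
  assumes "c < e" "t \<in> {c..e}" "\<And>s. s \<in> {c..e} \<Longrightarrow> F s = 0"
    and "(F has_vector_derivative D) (at t within {c..e})"
  shows "D = 0"
proof -
  have "(F has_vector_derivative 0) (at t within {c..e})"
    by (rule has_vector_derivative_transform[OF assms(2,3) has_vector_derivative_const])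
  with assms vector_derivative_unique_within_closed_interval[of c e t F D 0] show ?thesis by simp
qed

subsection \<open>Necessary conditions\<close>

text \<open>The equation on \<open>{T..b}\<close> is guarded by \<open>T < b\<close> because
  one-sided derivatives are not determined on a degenerate interval. Smoothness of \<open>L\<close>
  includes continuous partial derivatives, on which the uniform linearization rests.\<close>

theorem theorem57:
  fixes a b xa za T :: real
    and \<gamma> :: "real \<times> real"
    and \<alpha> \<beta> :: "real \<Rightarrow> real \<Rightarrow> real"
    and L :: "real \<times> real \<times> real \<times> real \<Rightarrow> real"
    and z :: "(real \<Rightarrow> real) \<Rightarrow> real \<Rightarrow> real"
    and x lam \<phi> :: "real \<Rightarrow> real"
  assumes "a < b"
    and "continuous_on ({a..b} \<times> {a..b}) (\<lambda>(s, \<tau>). \<alpha> s \<tau>)"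
    and "continuous_on ({a..b} \<times> {a..b}) (\<lambda>(s, \<tau>). \<beta> s \<tau>)"
    and "\<And>s \<tau>. s \<in> {a..b} \<Longrightarrow> \<tau> \<in> {a..b} \<Longrightarrow> \<alpha> s \<tau> \<in> {0<..<1}"
    and "\<And>s \<tau>. s \<in> {a..b} \<Longrightarrow> \<tau> \<in> {a..b} \<Longrightarrow> \<beta> s \<tau> \<in> {0<..<1}"
    and "fst \<gamma> \<in> {0..1}" and "snd \<gamma> \<in> {0..1}" and "\<gamma> \<noteq> (0, 0)"
    and "L differentiable_on ({a..b} \<times> UNIV)"
    and "continuous_on ({a..b} \<times> UNIV) (partial2 L)"
    and "continuous_on ({a..b} \<times> UNIV) (partial3 L)"
    and "continuous_on ({a..b} \<times> UNIV) (partial4 L)"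
    and "\<And>y. admissible a b xa y \<Longrightarrow> herglotz_solution a b \<gamma> \<alpha> \<beta> L za y (z y)"
    and "herglotz_extremum a b xa z x T"
    and "lam = herglotz_multiplier a b \<gamma> \<alpha> \<beta> L x (z x)"
    and "\<phi> = (\<lambda>t. lam t * partial3 L (bracket a b \<gamma> \<alpha> \<beta> x (z x) t))"
    and "RL_int_left \<beta> T \<phi> differentiable_on {T..b}"
    and "continuous_on {T..b} (RL_deriv_left b \<beta> T \<phi>)"
    and "RL_int_left \<beta> a \<phi> differentiable_on {a..b}"
    and "continuous_on {a..b} (RL_deriv_left b \<beta> a \<phi>)"
    and "RL_int_right \<alpha> T \<phi> differentiable_on {a..T}"
    and "continuous_on {a..T} (RL_deriv_comb a b T (prod.swap \<gamma>) \<beta> \<alpha> \<phi>)"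
  shows "(\<forall>t\<in>{a..T}. partial2 L (bracket a b \<gamma> \<alpha> \<beta> x (z x) t) * lam t
            + RL_deriv_comb a b T (prod.swap \<gamma>) \<beta> \<alpha> \<phi> t = 0)
    \<and> (T < b \<longrightarrow> (\<forall>t\<in>{T..b}.
            snd \<gamma> * (RL_deriv_left b \<beta> a \<phi> t - RL_deriv_left b \<beta> T \<phi> t) = 0))
    \<and> fst \<gamma> * RL_int_right \<alpha> T \<phi> T - snd \<gamma> * RL_int_left \<beta> T \<phi> T = 0
    \<and> snd \<gamma> * (RL_int_left \<beta> T \<phi> b - RL_int_left \<beta> a \<phi> b) = 0
    \<and> (T < b \<longrightarrow> L (bracket a b \<gamma> \<alpha> \<beta> x (z x) T) = 0)"
proof -
  note ab = assms(1) and L = assms(9) and P2 = assms(10) and P3 = assms(11) and P4 = assms(12)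
    and sol = assms(13) and extr = assms(14)
  obtain A1 where "variable_order a b A1 \<alpha>" using variable_orderI[OF ab assms(2,4)] by blast
  then interpret va: variable_order a b A1 \<alpha> .
  obtain A2 where "variable_order a b A2 \<beta>" using variable_orderI[OF ab assms(3,5)] by blast
  then interpret vb: variable_order a b A2 \<beta> .
  obtain e where adm: "admissible a b xa x" and T: "T \<in> {a<..b}" and e: "e > 0" and
    opt: "(\<forall>y S. admissible a b xa y \<and> S \<in> {a<..b} \<and> C1_near a b e x y \<and> \<bar>S - T\<bar> < e
           \<longrightarrow> z y S \<le> z x T) \<or>
        (\<forall>y S. admissible a b xa y \<and> S \<in> {a<..b} \<and> C1_near a b e x y \<and> \<bar>S - T\<bar> < e
           \<longrightarrow> z x T \<le> z y S)"
    using extr unfolding herglotz_extremum_def by blast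
  have aT: "a < T" and T': "T \<in> {a..b}" using T by auto

  \<comment> \<open>The extremal and the functions attached to it\<close>
  define x' where "x' = (\<lambda>t. vector_derivative x (at t within {a..b}))"
  define v where "v = caputo_comb a b \<gamma> \<alpha> \<beta> x"
  define \<gamma>1 \<gamma>2 where "\<gamma>1 = fst \<gamma>" and "\<gamma>2 = snd \<gamma>"
  have x'c: "continuous_on {a..b} x'" and xdiff: "x differentiable_on {a..b}"
    using adm by (auto simp: admissible_def C1_on_def x'_def)
  have x_deriv: "(x has_vector_derivative x' t) (at t within {a..b})" if "t \<in> {a..b}" for t
    using xdiff that unfolding x'_def by (simp add: differentiable_on_def vector_derivative_works)
  have xc: "continuous_on {a..b} x" using xdiff by (rule differentiable_imp_continuous_on)
  have vc: "continuous_on {a..b} v"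
    unfolding v_def caputo_comb_def[abs_def] caputo_left_def[abs_def] caputo_right_def[abs_def] x'_def[symmetric]
    by (intro continuous_intros va.continuous_on_RL_int_left vb.continuous_on_RL_int_right x'c)
  have z_deriv: "(z x has_real_derivative L (t, x t, v t, z x t)) (at t within {a..b})" if "t \<in> {a..b}" for t
    using sol[OF adm] that by (auto simp: herglotz_solution_def bracket_def v_def)
  have zc: "continuous_on {a..b} (z x)"
    using z_deriv by (meson DERIV_continuous continuous_on_eq_continuous_within)
  have comp: "continuous_on {a..b} (\<lambda>t. P (t, x t, v t, z x t))"
    if "continuous_on ({a..b} \<times> UNIV) P" for P :: "real \<times> real \<times> real \<times> real \<Rightarrow> real"
    by (rule continuous_on_compose2[OF that]) (auto intro!: continuous_intros xc vc zc)
  define p2 p3 p4 where "p2 = (\<lambda>t. partial2 L (t, x t, v t, z x t))"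
    and "p3 = (\<lambda>t. partial3 L (t, x t, v t, z x t))"
    and "p4 = (\<lambda>t. partial4 L (t, x t, v t, z x t))"
  have p: "continuous_on {a..b} p2" "continuous_on {a..b} p3" "continuous_on {a..b} p4"
    unfolding p2_def p3_def p4_def by (intro comp P2 P3 P4)+
  have lam: "lam t = exp (- integral {a..t} p4)" if "t \<in> {a..b}" for t
  proof -
    have "continuous_on {a..t} p4" using that by (intro continuous_on_subset[OF p(3)]) auto
    then have "(LINT \<tau>:{a..t}|lborel. p4 \<tau>) = integral {a..t} p4"
      by (intro set_borel_integral_eq_integral borel_integrable_atLeastAtMost')
    then show ?thesis by (simp add: assms(15) herglotz_multiplier_def bracket_def p4_def v_def)
  qed
  have "continuous_on {a..b} (\<lambda>t. exp (- integral {a..t} p4))"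
    by (intro continuous_intros indefinite_integral_continuous_1 integrable_continuous_real p)
  then have lamc: "continuous_on {a..b} lam" by (rule continuous_on_eq) (simp only: lam)
  have \<phi>: "\<phi> = (\<lambda>t. lam t * p3 t)"
    by (simp add: assms(16) p3_def bracket_def v_def)
  have \<phi>c: "continuous_on {a..b} \<phi>" unfolding \<phi> by (intro continuous_intros lamc p)
  define \<psi> where "\<psi> = (\<lambda>t. lam t * p2 t)"
  have \<psi>c: "continuous_on {a..b} \<psi>" unfolding \<psi>_def by (intro continuous_intros lamc p)
  \<comment> \<open>\<open>M\<close> plays for ordinary integration the role that \<open>R\<close>
    and \<open>I - I\<^sub>T\<close> play for the fractional integrals: the adjoint applied to the
    multiplier of the variation.\<close>
  define M where "M = (\<lambda>t. integral {t..T} \<psi>)"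
  define R where "R = RL_int_right \<alpha> T \<phi>"
  define I where "I = RL_int_left \<beta> a \<phi>"
  define I\<^sub>T where "I\<^sub>T = RL_int_left \<beta> T \<phi>"
  have R0: "R t = 0" if "T \<le> t" for t unfolding R_def using that by (rule RL_int_right_outside)
  have IT0: "I\<^sub>T t = 0" if "t \<le> T" for t unfolding I\<^sub>T_def using that by (rule RL_int_left_outside)
  have M0: "M t = 0" if "T \<le> t" for t using that unfolding M_def by (cases "t = T") auto
  have Rc': "continuous_on {a..T} R"
    unfolding R_def by (rule differentiable_imp_continuous_on[OF assms(21)])
  have Rc: "continuous_on {a..b} R"
    by (rule continuous_on_Icc_extend_right[OF Rc' R0 T'])
  have ITc': "continuous_on {T..b} I\<^sub>T"
    unfolding I\<^sub>T_def by (rule differentiable_imp_continuous_on[OF assms(17)])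
  have ITc: "continuous_on {a..b} I\<^sub>T"
    by (rule continuous_on_Icc_extend_left[OF ITc' IT0 T'])
  have Ic: "continuous_on {a..b} I" unfolding I_def by (rule vb.continuous_on_RL_int_left[OF \<phi>c])
  \<comment> \<open>Integration by parts turns the first variation in direction \<open>h\<close> into
    \<open>integral {a..b} (\<lambda>t. h' t * G t)\<close>, so the direction \<open>h' = G\<close> forces \<open>G = 0\<close>.\<close>
  define G where "G = (\<lambda>t. M t + \<gamma>1 * R t - \<gamma>2 * (I t - I\<^sub>T t))"
  define h where "h = (\<lambda>t. integral {a..t} G)"
  have Mc: "continuous_on {a..b} M"
    unfolding M_def by (rule integral_parts_primitive(2)[OF \<psi>c \<psi>c T' refl])
  have Gc: "continuous_on {a..b} G" unfolding G_def by (intro continuous_intros Mc Rc Ic ITc)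
  have h_deriv: "(h has_vector_derivative G t) (at t within {a..b})" if "t \<in> {a..b}" for t
    unfolding h_def using integral_has_real_derivative[OF Gc that]
    by (simp add: has_real_derivative_iff_has_vector_derivative)
  have hc: "continuous_on {a..b} h"
    unfolding h_def by (intro indefinite_integral_continuous_1 integrable_continuous_real Gc)
  \<comment> \<open>This is the combined Caputo derivative of \<open>h\<close>, written with
    \<open>G\<close> for \<open>h'\<close>; the minus sign is that of the right Caputo
    derivative.\<close>
  define k where "k = (\<lambda>t. \<gamma>1 * RL_int_left \<alpha> a G t - \<gamma>2 * RL_int_right \<beta> b G t)"
  have kc: "continuous_on {a..b} k"
    unfolding k_def by (intro continuous_intros va.continuous_on_RL_int_left vb.continuous_on_RL_int_right Gc)

  \<comment> \<open>The variation of \<open>x\<close> in the direction \<open>h\<close>\<close>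
  define y where "y = (\<lambda>\<epsilon> t. x t + \<epsilon> * h t)"
  have y_eq: "y \<epsilon> t = x t + \<epsilon> * h t" for \<epsilon> t by (simp add: y_def)
  have y_deriv: "(y \<epsilon> has_vector_derivative x' t + \<epsilon> * G t) (at t within {a..b})" if "t \<in> {a..b}" for \<epsilon> t
    using has_vector_derivative_add[OF x_deriv[OF that] has_vector_derivative_mult_right[OF h_deriv[OF that]]]
    by (simp add: y_def)
  have y': "vector_derivative (y \<epsilon>) (at t within {a..b}) = x' t + \<epsilon> * G t" if "t \<in> {a..b}" for \<epsilon> t
    using vector_derivative_within_closed_interval[OF ab that y_deriv[OF that]] .
  have y_adm: "admissible a b xa (y \<epsilon>)" for \<epsilon>
  proof -
    have "continuous_on {a..b} (\<lambda>t. x' t + \<epsilon> * G t)" by (intro continuous_intros x'c Gc)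
    then have "continuous_on {a..b} (\<lambda>t. vector_derivative (y \<epsilon>) (at t within {a..b}))"
      by (rule continuous_on_eq) (simp only: y')
    moreover have "y \<epsilon> differentiable_on {a..b}"
      unfolding differentiable_on_def using y_deriv differentiableI_vector by blast
    moreover have "y \<epsilon> a = xa" using adm by (simp add: y_def h_def admissible_def)
    ultimately show ?thesis by (simp add: admissible_def C1_on_def)
  qed
  have y_caputo: "caputo_comb a b \<gamma> \<alpha> \<beta> (y \<epsilon>) t = v t + \<epsilon> * k t" if t: "t \<in> {a..b}" for \<epsilon> t
  proof -
    have ends: "a \<in> {a..b}" "b \<in> {a..b}" using ab by auto
    have "caputo_left a b \<alpha> (y \<epsilon>) t = RL_int_left \<alpha> a (\<lambda>\<tau>. x' \<tau> + \<epsilon> * G \<tau>) t"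
      unfolding caputo_left_def using t by (intro RL_int_left_cong y') auto
    moreover have "caputo_right a b \<beta> (y \<epsilon>) t = - RL_int_right \<beta> b (\<lambda>\<tau>. x' \<tau> + \<epsilon> * G \<tau>) t"
      unfolding caputo_right_def using t by (intro arg_cong[of _ _ uminus] RL_int_right_cong y') auto
    moreover have "v t = \<gamma>1 * RL_int_left \<alpha> a x' t - \<gamma>2 * RL_int_right \<beta> b x' t"
      by (simp add: v_def caputo_comb_def caputo_left_def caputo_right_def x'_def \<gamma>1_def \<gamma>2_def)
    ultimately show ?thesis
      by (simp add: caputo_comb_def k_def \<gamma>1_def \<gamma>2_def va.RL_int_left_add_mult[OF ends(1) t x'c Gc]
          vb.RL_int_right_add_mult[OF ends(2) t x'c Gc]) (simp add: algebra_simps)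
  qed
  have y0: "y 0 = x" by (simp add: y_def)
  have "((\<lambda>\<epsilon>. z (y \<epsilon>) T) has_real_derivative
      integral {a..T} (\<lambda>t. lam t * (partial2 L (t, x t, v t, z (y 0) t) * h t + partial3 L (t, x t, v t, z (y 0) t) * k t))
        / lam T) (at 0)"
  proof (rule herglotz_first_variation[OF L P2 P3 P4 xc vc hc kc _ _ T'])
    fix \<epsilon> t assume t: "t \<in> {a..b}"
    show "(z (y \<epsilon>) has_real_derivative L (t, x t + \<epsilon> * h t, v t + \<epsilon> * k t, z (y \<epsilon>) t)) (at t within {a..b})"
      using sol[OF y_adm[of \<epsilon>]] y_caputo[OF t, of \<epsilon>] t
      by (auto simp: herglotz_solution_def bracket_def y_eq dest!: bspec[OF _ t])
  next
    fix \<epsilon> show "z (y \<epsilon>) a = z (y 0) a"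
      using sol[OF y_adm[of \<epsilon>]] sol[OF y_adm[of 0]] by (simp add: herglotz_solution_def)
  next
    fix t assume "t \<in> {a..b}"
    then show "lam t = exp (- integral {a..t} (\<lambda>s. partial4 L (s, x s, v s, z (y 0) s)))"
      using lam by (simp add: p4_def y0)
  qed
  then have var: "((\<lambda>\<epsilon>. z (y \<epsilon>) T) has_real_derivative
      integral {a..T} (\<lambda>t. lam t * (p2 t * h t + p3 t * k t)) / lam T) (at 0)"
    by (simp add: y0 p2_def p3_def)
  obtain B where B: "\<And>t. t \<in> {a..b} \<Longrightarrow> \<bar>h t\<bar> \<le> B" "\<And>t. t \<in> {a..b} \<Longrightarrow> \<bar>G t\<bar> \<le> B" "B > 0"
  proof -
    obtain B1 where B1: "B1 \<ge> 0" "\<And>t. t \<in> {a..b} \<Longrightarrow> norm (h t) \<le> B1"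
      using continuous_on_compact_bound[OF compact_Icc hc] by blast
    obtain B2 where B2: "B2 \<ge> 0" "\<And>t. t \<in> {a..b} \<Longrightarrow> norm (G t) \<le> B2"
      using continuous_on_compact_bound[OF compact_Icc Gc] by blast
    show thesis by (rule that[of "B1 + B2 + 1"]) (use B1 B2 in fastforce)+
  qed
  \<comment> \<open>\<open>B\<close> bounds both \<open>h\<close> and its derivative
    \<open>G\<close>, so this range of \<epsilon> keeps the variation within distance
    \<open>e\<close> of \<open>x\<close> in the sense of \<open>C1_near\<close>.\<close>
  have near: "C1_near a b e x (y \<epsilon>)" if "\<bar>0 - \<epsilon>\<bar> < e / B" for \<epsilon>
    unfolding C1_near_def
  proof (intro ballI conjI)
    fix t assume t: "t \<in> {a..b}"
    have "\<bar>\<epsilon>\<bar> * B < e" using that B(3) by (simp add: pos_less_divide_eq)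
    moreover have "\<bar>\<epsilon>\<bar> * \<bar>h t\<bar> \<le> \<bar>\<epsilon>\<bar> * B" "\<bar>\<epsilon>\<bar> * \<bar>G t\<bar> \<le> \<bar>\<epsilon>\<bar> * B"
      using B t by (auto intro!: mult_left_mono)
    ultimately show "\<bar>y \<epsilon> t - x t\<bar> < e"
      "\<bar>vector_derivative (y \<epsilon>) (at t within {a..b}) - vector_derivative x (at t within {a..b})\<bar> < e"
      by (simp_all add: y'[OF t] y_eq abs_mult fun_cong[OF x'_def, symmetric])
  qed
  \<comment> \<open>Fermat's criterion at \<epsilon> = 0, with the terminal time held at
    \<open>T\<close>.\<close>
  have "integral {a..T} (\<lambda>t. lam t * (p2 t * h t + p3 t * k t)) / lam T = 0"
    using opt
  proof
    assume "\<forall>y S. admissible a b xa y \<and> S \<in> {a<..b} \<and> C1_near a b e x y \<and> \<bar>S - T\<bar> < e \<longrightarrow> z y S \<le> z x T"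
    then show ?thesis using T e B(3) y_adm near
      by (intro DERIV_local_max[OF var, of "e / B"]) (auto simp: y0)
  next
    assume "\<forall>y S. admissible a b xa y \<and> S \<in> {a<..b} \<and> C1_near a b e x y \<and> \<bar>S - T\<bar> < e \<longrightarrow> z x T \<le> z y S"
    then show ?thesis using T e B(3) y_adm near
      by (intro DERIV_local_min[OF var, of "e / B"]) (auto simp: y0)
  qed
  then have J0: "integral {a..T} (\<lambda>t. lam t * (p2 t * h t + p3 t * k t)) = 0"
    using lam[OF T'] by simp
  have sub: "continuous_on {a..T} F" if "continuous_on {a..b} F" for F :: "real \<Rightarrow> real"
    using T by (intro continuous_on_subset[OF that]) auto
  have "integral {a..T} (\<lambda>t. lam t * (p2 t * h t + p3 t * k t)) =
      integral {a..T} (\<lambda>t. \<psi> t * h t + \<gamma>1 * (\<phi> t * RL_int_left \<alpha> a G t) - \<gamma>2 * (\<phi> t * RL_int_right \<beta> b G t))"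
    by (intro Henstock_Kurzweil_Integration.integral_cong) (simp add: \<psi>_def \<phi> k_def algebra_simps)
  also have "\<dots> = integral {a..T} (\<lambda>t. \<psi> t * h t) + \<gamma>1 * integral {a..T} (\<lambda>t. \<phi> t * RL_int_left \<alpha> a G t)
      - \<gamma>2 * integral {a..T} (\<lambda>t. \<phi> t * RL_int_right \<beta> b G t)"
  proof -
    have [simp]: "(\<lambda>t. \<psi> t * h t) integrable_on {a..T}" "(\<lambda>t. \<phi> t * RL_int_left \<alpha> a G t) integrable_on {a..T}"
      "(\<lambda>t. \<phi> t * RL_int_right \<beta> b G t) integrable_on {a..T}"
      by (intro integrable_continuous_real sub continuous_intros \<psi>c hc \<phi>c
          va.continuous_on_RL_int_left vb.continuous_on_RL_int_right Gc)+
    show ?thesis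
      by (simp add: Henstock_Kurzweil_Integration.integral_diff Henstock_Kurzweil_Integration.integral_add
          integrable_add integrable_on_mult_right)
  qed
  \<comment> \<open>Each operator is moved off \<open>G\<close>; the coefficients of
    \<open>G\<close> that appear are exactly the summands of the definition of \<open>G\<close>, so
    the sum becomes the integral of its square.\<close>
  also have "\<dots> = integral {a..b} (\<lambda>t. G t * M t) + \<gamma>1 * integral {a..b} (\<lambda>t. G t * R t)
      - \<gamma>2 * integral {a..b} (\<lambda>t. G t * (I t - I\<^sub>T t))"
    using integral_parts_primitive(1)[OF \<psi>c Gc T', of h]
      va.RL_parts_left[OF \<phi>c Gc T' Rc'[unfolded R_def]]
      vb.RL_parts_right[OF \<phi>c Gc T' ITc'[unfolded I\<^sub>T_def]]
    by (simp add: h_def M_def R_def I_def I\<^sub>T_def)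
  also have "\<dots> = integral {a..b} (\<lambda>t. G t * M t + \<gamma>1 * (G t * R t) - \<gamma>2 * (G t * (I t - I\<^sub>T t)))"
  proof -
    have [simp]: "(\<lambda>t. G t * M t) integrable_on {a..b}" "(\<lambda>t. G t * R t) integrable_on {a..b}"
      "(\<lambda>t. G t * (I t - I\<^sub>T t)) integrable_on {a..b}"
      by (intro integrable_continuous_real continuous_intros Gc Mc Rc Ic ITc)+
    show ?thesis
      by (simp add: Henstock_Kurzweil_Integration.integral_diff Henstock_Kurzweil_Integration.integral_add
          integrable_add integrable_on_mult_right)
  qed
  also have "\<dots> = integral {a..b} (\<lambda>t. G t * G t)"
    by (intro Henstock_Kurzweil_Integration.integral_cong) (simp add: G_def algebra_simps)
  finally have "integral {a..b} (\<lambda>t. G t * G t) = 0" using J0 by simp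
  moreover have "continuous_on {a..b} (\<lambda>t. G t * G t)" by (intro continuous_intros Gc)
  ultimately have G0: "G t = 0" if "t \<in> {a..b}" for t
    using integral_eq_0_iff[of a b "\<lambda>t. G t * G t"] ab that by auto

  \<comment> \<open>Euler-Lagrange equations, transversality and the optimal terminal time\<close>
  have I_deriv: "(I has_vector_derivative RL_deriv_left b \<beta> a \<phi> t) (at t within {a..b})" if "t \<in> {a..b}" for t
    using assms(19) that unfolding I_def RL_deriv_left_def
    by (simp add: differentiable_on_def vector_derivative_works)
  \<comment> \<open>Before \<open>T\<close> the term \<open>I\<^sub>T\<close> vanishes, and the
    derivative of the rest of \<open>G\<close> is minus the left-hand side of the equation;
    \<open>R\<close> contributes minus the right derivative by the sign in its definition.\<close>
  have EL1: "\<psi> t + RL_deriv_comb a b T (prod.swap \<gamma>) \<beta> \<alpha> \<phi> t = 0" if t: "t \<in> {a..T}" for t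
  proof -
    have "(R has_vector_derivative - RL_deriv_right a \<alpha> T \<phi> t) (at t within {a..T})"
      using assms(21) t unfolding R_def RL_deriv_right_def
      by (simp add: differentiable_on_def vector_derivative_works)
    moreover have "(M has_vector_derivative - \<psi> t) (at t within {a..T})"
      unfolding M_def using integral_has_real_derivative'[OF sub[OF \<psi>c] t]
      by (simp add: has_real_derivative_iff_has_vector_derivative)
    moreover have "(I has_vector_derivative RL_deriv_left b \<beta> a \<phi> t) (at t within {a..T})"
      using t T by (intro has_vector_derivative_within_subset[OF I_deriv]) auto
    ultimately have "((\<lambda>t. M t + \<gamma>1 * R t - \<gamma>2 * I t) has_vector_derivative
        - \<psi> t + \<gamma>1 * - RL_deriv_right a \<alpha> T \<phi> t - \<gamma>2 * RL_deriv_left b \<beta> a \<phi> t) (at t within {a..T})"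
      by (intro has_vector_derivative_add has_vector_derivative_diff has_vector_derivative_mult_right)
    moreover have "M s + \<gamma>1 * R s - \<gamma>2 * I s = 0" if "s \<in> {a..T}" for s
      using G0[of s] that T IT0[of s] by (simp add: G_def)
    ultimately have "- \<psi> t + \<gamma>1 * - RL_deriv_right a \<alpha> T \<phi> t - \<gamma>2 * RL_deriv_left b \<beta> a \<phi> t = 0"
      by (rule zero_function_derivative[OF aT t, rotated])
    then show ?thesis by (simp add: RL_deriv_comb_def \<gamma>1_def \<gamma>2_def)
  qed
  \<comment> \<open>After \<open>T\<close> both \<open>M\<close> and \<open>R\<close> vanish, so
    \<open>G = 0\<close> reduces to the difference of the left integrals.\<close>
  have EL2: "\<gamma>2 * (RL_deriv_left b \<beta> a \<phi> t - RL_deriv_left b \<beta> T \<phi> t) = 0" if "T < b" and t: "t \<in> {T..b}" for t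
  proof -
    have "(I\<^sub>T has_vector_derivative RL_deriv_left b \<beta> T \<phi> t) (at t within {T..b})"
      using assms(17) t unfolding I\<^sub>T_def RL_deriv_left_def
      by (simp add: differentiable_on_def vector_derivative_works)
    moreover have "(I has_vector_derivative RL_deriv_left b \<beta> a \<phi> t) (at t within {T..b})"
      using t T by (intro has_vector_derivative_within_subset[OF I_deriv]) auto
    ultimately have "((\<lambda>t. \<gamma>2 * (I t - I\<^sub>T t)) has_vector_derivative
        \<gamma>2 * (RL_deriv_left b \<beta> a \<phi> t - RL_deriv_left b \<beta> T \<phi> t)) (at t within {T..b})"
      by (intro has_vector_derivative_diff has_vector_derivative_mult_right)
    moreover have "\<gamma>2 * (I s - I\<^sub>T s) = 0" if "s \<in> {T..b}" for s
      using G0[of s] that T M0[of s] R0[of s] by (auto simp: G_def)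
    ultimately show ?thesis by (rule zero_function_derivative[OF \<open>T < b\<close> t, rotated])
  qed
  have TC2: "\<gamma>2 * (I\<^sub>T b - I b) = 0"
    using G0[of b] ab T M0[of b] R0[of b] by (auto simp: G_def algebra_simps)
  \<comment> \<open>Now the trajectory \<open>x\<close> is kept and only the terminal time moves. An
    interior \<open>T\<close> gives a two-sided derivative of \<open>z x\<close>, and
    \<open>r\<close> keeps the competing times inside the interval and within \<open>e\<close> of
    \<open>T\<close>.\<close>
  have "L (T, x T, v T, z x T) = 0" if "T < b"
  proof -
    have "(z x has_real_derivative L (T, x T, v T, z x T)) (at T)"
      using z_deriv[OF T'] at_within_Icc_at[OF aT that] by simp
    note deriv = this
    define r where "r = min e (min (T - a) (b - T))"
    have r: "r > 0" using e aT that by (simp add: r_def)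
    have near: "C1_near a b e x x" using e by (simp add: C1_near_def)
    have mem: "S \<in> {a<..b} \<and> \<bar>S - T\<bar> < e" if "\<bar>T - S\<bar> < r" for S using that by (auto simp: r_def)
    show ?thesis using opt
    proof
      assume "\<forall>y S. admissible a b xa y \<and> S \<in> {a<..b} \<and> C1_near a b e x y \<and> \<bar>S - T\<bar> < e \<longrightarrow> z y S \<le> z x T"
      then show ?thesis using adm near mem by (intro DERIV_local_max[OF deriv r]) blast
    next
      assume "\<forall>y S. admissible a b xa y \<and> S \<in> {a<..b} \<and> C1_near a b e x y \<and> \<bar>S - T\<bar> < e \<longrightarrow> z x T \<le> z y S"
      then show ?thesis using adm near mem by (intro DERIV_local_min[OF deriv r]) blast
    qed
  qed
  \<comment> \<open>The first transversality condition holds because both integrals are taken over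
    the single point \<open>T\<close> and have the value 0.\<close>
  with EL1 EL2 TC2 R0[of T] IT0[of T] show ?thesis
    by (simp add: bracket_def v_def[symmetric] \<psi>_def p2_def mult.commute \<gamma>1_def \<gamma>2_def R_def I_def I\<^sub>T_def)
qed

end
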